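(* Let $V^{[*]}$ be a dg vertex operator algebra. Then $(A(V^{[*]}),F^\bullet A(V^{[*]}),\ast,d_V)$ is a differential filtered commutative algebra, i.e. it is a differential filtered algebra in which any two elements $x,y$ satisfy $x\ast y-(-1)^{|x||y|}y\ast x\in F^{|x|+|y|-1}A(V^{[*]})$.
   Context: All vector spaces are over $\mathbb C$. A (cochain) complex $V^{[*]}=\bigoplus_{p\in\mathbb Z}V^{[p]}$ has a differential $d_V$ of degree $+1$ with $d_V^2=0$; $|v|=p$ for $v\in V^{[p]}$. $\operatorname{End}^{[*]}(V^{[*]})=\bigoplus_p\operatorname{End}^{[p]}(V^{[*]})$, where $\operatorname{End}^{[p]}$ is the space of linear maps of degree $p$. A dg vertex algebra $(V^{[*]},d_V,Y(\cdot,x),\mathbf 1)$ is a complex with a linear map $v\mapsto Y(v,x)=\sum_{n\in\mathbb Z}v_nx^{-n-1}\in\operatorname{End}^{[*]}(V^{[*]})[[x,x^{-1}]]$ such that for $v\in V^{[p]}$ one has $v_n\in\operatorname{End}^{[p-2n-2]}(V^{[*]})$ and $(d_Vv)_n=d_V\circ v_n-(-1)^{p}v_n\circ d_V$, and a vector $\mathbf 1\in V^{[0]}$ with $d_V\mathbf 1=0$, such that: $u_nv=0$ for $n$ sufficiently large; $Y(\mathbf 1,x)=\operatorname{id}$; $Y(v,x)\mathbf 1\in V^{[*]}[[x]]$ with constant term $v$; and (Jacobi identity) for homogeneous $u,v$ and all $l,m,n\in\mathbb Z$, $$\sum_{i\ge0}(-1)^i\binom li\left(u_{m+l-i}v_{n+i}-(-1)^{l}(-1)^{|u||v|}v_{n+l-i}u_{m+i}\right)=\sum_{i\ge0}\binom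 mi(u_{l+i}v)_{m+n-i}.$$ A dg vertex operator algebra is a dg vertex algebra with $\omega\in V^{[4]}$, $d_V\omega=0$, such that, writing $Y(\omega,x)=\sum_nL(n)x^{-n-2}$: $[L(m),L(n)]=(m-n)L(m+n)+\frac1{12}(m^3-m)\delta_{m+n,0}c_V$ for some $c_V\in\mathbb C$; $L(0)$ is semisimple with $V^{[*]}=\bigoplus_{n\in\frac12\mathbb Z}V_n^{[*]}$, $V_n^{[*]}$ the eigenspace of eigenvalue (weight) $n$, $\omega\in V_2^{[*]}$, $\dim V_n^{[*]}<\infty$, $V_n^{[*]}=0$ for $n\ll0$; and $L(-1)v=v_{-2}\mathbf 1$. Write $\operatorname{wt}(u)=n$ for $u\in V_n^{[*]}$. Zhu algebra: for $u$ weight homogeneous and $v\in V^{[*]}$ (extended linearly in $u$), $u\ast v=\sum_{n\ge0}\binom{\operatorname{wt}(u)}{n}u_{n-1}v$ and $u\circ v=\sum_{n\ge0}\binom{\operatorname{wt}(u)}{n}u_{n-2}v$. $O(V^{[*]})$ is the span of all $u\circ v$, and $A(V^{[*]})=V^{[*]}/O(V^{[*]})$; $\ast$ descends to an associative unital product on $A(V^{[*]})$, and $d_V(O(V^{[*]}))\subseteq O(V^{[*]})$, so $d_V$ induces a linear map $d_V$ on $A(V^{[*]})$. $F^pA(V^{[*]})$ is the image of $\bigoplus_{q\le p}V^{[q]}$ in $A(V^{[*]})$. A differential filtered vector space $(A,F^\bullet A,d_A)$ is a vector space with an increasing $\mathbb Z$-indexed filtration with $\bigcap_iF^iA=0$,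 $\bigcup_iF^iA=A$, and a linear map $d_A$ with $d_AF^iA\subseteq F^{i+1}A$, $d_A^2F^iA\subseteq F^{i+1}A$; for $a\neq0$, $|a|=\min\{i\mid a\in F^iA\}$. It is a differential filtered algebra if it has an associative product $\ast$ with $F^iA\ast F^jA\subseteq F^{i+j}A$ and $d_A(a\ast b)-(d_Aa\ast b+(-1)^{|a|}a\ast d_Ab)\in F^{|a|+|b|}A$. *)

theory Defs
  imports
    Complex_Main
    "HOL-Library.Groups_Big_Fun"
    "HOL-Algebra.Algebraic_Closure_Type"
begin

section \<open>Internal direct sums\<close>

definition decomposes ::
    "'i set \<Rightarrow> ('i \<Rightarrow> 'v::comm_monoid_add set) \<Rightarrow> 'v \<Rightarrow> ('i \<Rightarrow> 'v) \<Rightarrow> bool"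
  where "decomposes I G v f \<longleftrightarrow>
    (\<forall>i\<in>I. f i \<in> G i) \<and> (\<forall>i. i \<notin> I \<longrightarrow> f i = 0) \<and> finite {i. f i \<noteq> 0} \<and> v = Sum_any f"

definition component ::
    "'i set \<Rightarrow> ('i \<Rightarrow> 'v::comm_monoid_add set) \<Rightarrow> 'v \<Rightarrow> 'i \<Rightarrow> 'v"
  where "component I G v = (THE f. decomposes I G v f)"

definition (in vector_space) internal_direct_sum :: "'i set \<Rightarrow> ('i \<Rightarrow> 'b set) \<Rightarrow> bool"
  where "internal_direct_sum I G \<longleftrightarrow>
    (\<forall>i\<in>I. subspace (G i)) \<and> (\<forall>v. \<exists>!f. decomposes I G v f)"


section \<open>Dg vertex operator algebras\<close>

locale cochain_complex = vector_space scale
  for scale :: "complex \<Rightarrow> 'v::ab_group_add \<Rightarrow> 'v" (infixr \<open>*s\<close> 75) +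
  fixes deg :: "int \<Rightarrow> 'v set" and d :: "'v \<Rightarrow> 'v"
  assumes deg_direct_sum: "internal_direct_sum UNIV deg"
    and d_linear: "Vector_Spaces.linear scale scale d"
    and d_deg: "v \<in> deg p \<Longrightarrow> d v \<in> deg (p + 1)"
    and d_d: "d (d v) = 0"

text \<open>\<open>mode u n v\<close> is $u_n v$, where $Y(u,x) = \sum_n u_n x^{-n-1}$.\<close>

locale dg_vertex_algebra = cochain_complex scale deg d
  for scale :: "complex \<Rightarrow> 'v::ab_group_add \<Rightarrow> 'v" (infixr \<open>*s\<close> 75) and deg d +
  fixes mode :: "'v \<Rightarrow> int \<Rightarrow> 'v \<Rightarrow> 'v" and vac :: 'v
  assumes mode_linear_left: "Vector_Spaces.linear scale scale (\<lambda>u. mode u n v)"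
    and mode_linear_right: "Vector_Spaces.linear scale scale (mode u n)"
    and mode_deg: "\<lbrakk>u \<in> deg p; v \<in> deg q\<rbrakk> \<Longrightarrow> mode u n v \<in> deg (q + (p - 2 * n - 2))"
    and mode_d: "u \<in> deg p \<Longrightarrow>
      mode (d u) n v = d (mode u n v) - ((-1) powi p) *s mode u n (d v)"
    and vac_deg: "vac \<in> deg 0"
    and d_vac: "d vac = 0"
    and truncation: "\<exists>N. \<forall>n\<ge>N. mode u n v = 0"
    and vac_mode: "mode vac n v = (if n = -1 then v else 0)"
    and creation: "n \<ge> 0 \<Longrightarrow> mode v n vac = 0" "mode v (-1) vac = v"
    and jacobi: "\<lbrakk>u \<in> deg p; v \<in> deg q\<rbrakk> \<Longrightarrow>
      Sum_any (\<lambda>i::nat. ((-1) ^ i * (of_int l gchoose i)) *s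
        (mode u (m + l - int i) (mode v (n + int i) w)
          - ((-1) powi l * (-1) powi (p * q)) *s
            mode v (n + l - int i) (mode u (m + int i) w)))
      = Sum_any (\<lambda>i::nat. (of_int m gchoose i) *s
          mode (mode u (l + int i) v) (m + n - int i) w)"
begin

text \<open>$Y(\omega,x) = \sum_n L(n) x^{-n-2}$, hence $L(n) = \omega_{n+1}$.\<close>

definition L :: "'v \<Rightarrow> int \<Rightarrow> 'v \<Rightarrow> 'v"
  where "L \<omega> n = mode \<omega> (n + 1)"

definition weight_space :: "'v \<Rightarrow> real \<Rightarrow> 'v set"
  where "weight_space \<omega> r = {v. L \<omega> 0 v = complex_of_real r *s v}"

end

definition half_integers :: "real set"
  where "half_integers = {r. 2 * r \<in> \<int>}"

locale dg_vertex_operator_algebra = dg_vertex_algebra scale deg d mode vac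
  for scale :: "complex \<Rightarrow> 'v::ab_group_add \<Rightarrow> 'v" (infixr \<open>*s\<close> 75) and deg d mode vac +
  fixes \<omega> :: 'v
  assumes conformal_deg: "\<omega> \<in> deg 4"
    and d_conformal: "d \<omega> = 0"
    and virasoro: "\<exists>c::complex. \<forall>m n v.
      L \<omega> m (L \<omega> n v) - L \<omega> n (L \<omega> m v) =
        of_int (m - n) *s L \<omega> (m + n) v
        + (if m + n = 0 then (1 / 12 * of_int (m ^ 3 - m) * c) *s v else 0)"
    and weight_direct_sum: "internal_direct_sum half_integers (weight_space \<omega>)"
    and conformal_weight: "\<omega> \<in> weight_space \<omega> 2"
    and weight_finite_dim: "r \<in> half_integers \<Longrightarrow> \<exists>B. finite B \<and> span B = weight_space \<omega> r"
    and weight_bounded_below: "\<exists>N. \<forall>r\<in>half_integers. r < N \<longrightarrow> weight_space \<omega> r = {0}"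
    and L_minus_one: "L \<omega> (-1) v = mode v (-2) vac"
begin

section \<open>The Zhu algebra\<close>

text \<open>
  \<open>zhu_product (-1)\<close> and \<open>zhu_product (-2)\<close> are the linear extensions in \<open>u\<close>, along the
  weight decomposition, of $\sum_{n \ge 0} \binom{\mathrm{wt}(u)}{n} u_{n+k} v$ for
  $k = -1$ and $k = -2$.
\<close>

definition zhu_product :: "int \<Rightarrow> 'v \<Rightarrow> 'v \<Rightarrow> 'v"
  where "zhu_product k u v =
    Sum_any (\<lambda>r::real. Sum_any (\<lambda>n::nat. (complex_of_real r gchoose n) *s
      mode (component half_integers (weight_space \<omega>) u r) (int n + k) v))"

definition zhu_star :: "'v \<Rightarrow> 'v \<Rightarrow> 'v"
  where "zhu_star = zhu_product (-1)"

definition zhu_circ :: "'v \<Rightarrow> 'v \<Rightarrow> 'v"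
  where "zhu_circ = zhu_product (-2)"

definition zhu_O :: "'v set"
  where "zhu_O = span {zhu_circ u v | u v. True}"

definition zhu_class :: "'v \<Rightarrow> 'v set"
  where "zhu_class v = {v + w | w. w \<in> zhu_O}"

text \<open>
  The operations on cosets are unions over all representatives, so that such a union is again
  a coset precisely when the operation descends to the quotient by \<^term>\<open>zhu_O\<close>.
\<close>

definition zhu_algebra :: "(complex, 'v set) module"
  where "zhu_algebra =
    \<lparr>carrier = range zhu_class,
     monoid.mult = (\<lambda>S T. \<Union>x\<in>S. \<Union>y\<in>T. zhu_class (zhu_star x y)),
     one = zhu_class vac,
     zero = zhu_class 0,
     add = (\<lambda>S T. \<Union>x\<in>S. \<Union>y\<in>T. zhu_class (x + y)),
     module.smult = (\<lambda>c S. \<Union>x\<in>S. zhu_class (c *s x))\<rparr>"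

definition zhu_d :: "'v set \<Rightarrow> 'v set"
  where "zhu_d S = (\<Union>x\<in>S. zhu_class (d x))"

definition zhu_filtration :: "int \<Rightarrow> 'v set set"
  where "zhu_filtration p = zhu_class ` span (\<Union>q\<in>{..p}. deg q)"

end


section \<open>Differential filtered algebras\<close>

abbreviation complex_ring :: "complex ring"
  where "complex_ring \<equiv> ring_of_type_algebra"

text \<open>Only the module structure of the record \<open>A\<close> is constrained here, not its product.\<close>

locale differential_filtered_vector_space = Module.module complex_ring A
  for A :: "(complex, 'a) module" (structure) +
  fixes F :: "int \<Rightarrow> 'a set" and d :: "'a \<Rightarrow> 'a"
  assumes filtration_submodule: "submodule (F i) complex_ring A"
    and filtration_mono: "i \<le> j \<Longrightarrow> F i \<subseteq> F j"
    and filtration_separated: "(\<Inter>i. F i) = {\<zero>}"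
    and filtration_exhaustive: "(\<Union>i. F i) = carrier A"
    and d_closed: "a \<in> carrier A \<Longrightarrow> d a \<in> carrier A"
    and d_add: "\<lbrakk>a \<in> carrier A; b \<in> carrier A\<rbrakk> \<Longrightarrow> d (a \<oplus> b) = d a \<oplus> d b"
    and d_smult: "a \<in> carrier A \<Longrightarrow> d (c \<odot> a) = c \<odot> d a"
    and d_filtration: "a \<in> F i \<Longrightarrow> d a \<in> F (i + 1)"
    and d_d_filtration: "a \<in> F i \<Longrightarrow> d (d a) \<in> F (i + 1)"

text \<open>Meaningful for nonzero \<open>a\<close> only; the minimum then exists by separatedness.\<close>

definition filtration_degree :: "(int \<Rightarrow> 'a set) \<Rightarrow> 'a \<Rightarrow> int"
  where "filtration_degree F a = (LEAST i. a \<in> F i)"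

locale differential_filtered_algebra = differential_filtered_vector_space A F d
  for A :: "(complex, 'a) module" (structure) and F d +
  assumes mult_closed: "\<lbrakk>a \<in> carrier A; b \<in> carrier A\<rbrakk> \<Longrightarrow> a \<otimes> b \<in> carrier A"
    and mult_assoc: "\<lbrakk>a \<in> carrier A; b \<in> carrier A; c \<in> carrier A\<rbrakk> \<Longrightarrow>
      (a \<otimes> b) \<otimes> c = a \<otimes> (b \<otimes> c)"
    and mult_add_left: "\<lbrakk>a \<in> carrier A; b \<in> carrier A; c \<in> carrier A\<rbrakk> \<Longrightarrow>
      (a \<oplus> b) \<otimes> c = a \<otimes> c \<oplus> b \<otimes> c"
    and mult_add_right: "\<lbrakk>a \<in> carrier A; b \<in> carrier A; c \<in> carrier A\<rbrakk> \<Longrightarrow>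
      a \<otimes> (b \<oplus> c) = a \<otimes> b \<oplus> a \<otimes> c"
    and mult_smult_left: "\<lbrakk>a \<in> carrier A; b \<in> carrier A\<rbrakk> \<Longrightarrow>
      (z \<odot> a) \<otimes> b = z \<odot> (a \<otimes> b)"
    and mult_smult_right: "\<lbrakk>a \<in> carrier A; b \<in> carrier A\<rbrakk> \<Longrightarrow>
      a \<otimes> (z \<odot> b) = z \<odot> (a \<otimes> b)"
    and mult_filtration: "\<lbrakk>a \<in> F i; b \<in> F j\<rbrakk> \<Longrightarrow> a \<otimes> b \<in> F (i + j)"
    and leibniz: "\<lbrakk>a \<in> carrier A; b \<in> carrier A; a \<noteq> \<zero>; b \<noteq> \<zero>\<rbrakk> \<Longrightarrow>
      d (a \<otimes> b) \<ominus> (d a \<otimes> b \<oplus> ((-1) powi filtration_degree F a) \<odot> (a \<otimes> d b))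
        \<in> F (filtration_degree F a + filtration_degree F b)"

locale differential_filtered_commutative_algebra = differential_filtered_algebra A F d
  for A :: "(complex, 'a) module" (structure) and F d +
  assumes filtered_commutative: "\<lbrakk>x \<in> carrier A; y \<in> carrier A; x \<noteq> \<zero>; y \<noteq> \<zero>\<rbrakk> \<Longrightarrow>
      x \<otimes> y \<ominus> ((-1) powi (filtration_degree F x * filtration_degree F y)) \<odot> (y \<otimes> x)
        \<in> F (filtration_degree F x + filtration_degree F y - 1)"

end

theory Submission
  imports Defs "HOL-Computational_Algebra.Formal_Power_Series"
begin

text \<open>
  For weight homogeneous \<open>u\<close> the products defining the Zhu algebra are residues
  $\mathrm{Res}_x\, (1+x)^a x^k\, Y(u,x)v$ with \<open>a\<close> the weight of \<open>u\<close>; for general complex \<open>a\<close> and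
  integer \<open>k\<close> such a residue is called \<open>residue a k u v\<close> below. Half-integral weights cause no
  trouble, because $(1+x)^a$ is only ever expanded as a power series in \<open>x\<close>.

  \<^bold>\<open>Algebra.\<close> Summing the Jacobi identity against binomial coefficients gives one identity between
  residues (\<open>borcherds_residue\<close>). It expresses $(u \ast v) \ast w$ as $u \ast (v \ast w)$ plus residues of \<open>u\<close>
  and \<open>v\<close> with \<open>a\<close> their weight and \<open>k \<le> -2\<close>, and treats $(u \ast v) \circ w$ and $(u \circ v) \ast w$ alike. Such
  residues lie in \<open>zhu_O\<close>, because $L(-1)u$ has weight one higher than \<open>u\<close> and integration by parts lowers \<open>k\<close>
  (\<open>residue_in_zhu_O\<close>). Hence \<open>zhu_O\<close> is a two-sided ideal and the product is associative modulo it.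

  \<^bold>\<open>Commutativity.\<close> Modulo \<open>zhu_O\<close> the operator $L(-1)$ is minus the weight, so $e^{xL(-1)}$ acts as
  $(1+x)^{-L(0)}$, and skew symmetry turns $v \ast u$ into $\pm\mathrm{Res}_x\, (1+x)^{a-1} x^{-1} Y(u,x)v$.
  Modulo \<open>zhu_O\<close> the supercommutator is therefore $\mathrm{Res}_x\, (1+x)^{a-1} Y(u,x)v$ (\<open>zhu_commutator\<close>), a
  combination of $u_n v$ with $n \ge 0$, and $u_n v$ has degree $|u|+|v|-2n-2$. This gains
  two steps of the filtration, whereas the product $u_{-1}v + \dots$ has degree at most $|u|+|v|$.

  \<^bold>\<open>Differential.\<close> Since $d\omega = 0$ and \<open>\<omega>\<close> has even degree, \<open>d\<close> commutes with $L(0)$ and is an honest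
  graded derivation of both Zhu products. The Leibniz rule and commutativity are checked on leading
  terms; a term of lower degree may carry the wrong sign but is absorbed by the filtration.

  \<^bold>\<open>Separatedness.\<close> The weights of $u_n v$ drop by \<open>1\<close> and the degrees by \<open>2\<close> when \<open>n\<close> increases by \<open>1\<close>, so both
  Zhu products are homogeneous for the grading by degree minus twice the weight, and the Zhu
  algebra inherits this grading. Within one graded piece, small degree means small weight, and
  weights are bounded below; so each graded piece of an element in every filtration step vanishes
  (\<open>zhu_filtration_separated\<close>).
\<close>

section \<open>Finitely supported sums\<close>

lemma Sum_any_Suc_shift:
  fixes f :: "nat \<Rightarrow> 'v::comm_monoid_add"
  assumes "finite {n. f n \<noteq> 0}"
  shows "Sum_any f = f 0 + Sum_any (\<lambda>n. f (Suc n))"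
proof -
  obtain N where N: "{n. f n \<noteq> 0} \<subseteq> {..<N}"
    using assms finite_nat_set_iff_bounded by auto
  have "Sum_any f = sum f {..<Suc N}"
    using N by (intro Sum_any.expand_superset) auto
  also have "\<dots> = f 0 + (\<Sum>n<N. f (Suc n))"
    by (rule sum.lessThan_Suc_shift)
  also have "(\<Sum>n<N. f (Suc n)) = Sum_any (\<lambda>n. f (Suc n))"
    using N by (intro Sum_any.expand_superset [symmetric]) auto
  finally show ?thesis .
qed

lemma Sum_any_only_zero:
  fixes f :: "nat \<Rightarrow> 'v::comm_monoid_add"
  assumes "\<And>n. n > 0 \<Longrightarrow> f n = 0"
  shows "Sum_any f = f 0"
proof -
  have "Sum_any f = sum f {0}"
    using assms by (intro Sum_any.expand_superset) (auto intro: ccontr)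
  then show ?thesis by simp
qed

lemma Sum_any_swap:
  fixes f :: "'a \<Rightarrow> 'b \<Rightarrow> 'v::comm_monoid_add"
  assumes "finite {(i, j). f i j \<noteq> 0}"
  shows "Sum_any (\<lambda>i. Sum_any (\<lambda>j. f i j)) = Sum_any (\<lambda>j. Sum_any (\<lambda>i. f i j))"
proof (rule Sum_any.swap)
  let ?S = "{(i, j). f i j \<noteq> 0}"
  show "finite (fst ` ?S \<times> snd ` ?S)" using assms by simp
  show "{i. \<exists>j. f i j \<noteq> 0} \<times> {j. \<exists>i. f i j \<noteq> 0} \<subseteq> fst ` ?S \<times> snd ` ?S"
    by force
qed

lemma finite_support_fibres:
  assumes "finite {i. \<exists>j. P i j}" and "\<And>i. finite {j. P i j}"
  shows "finite {(i, j). P i j}"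
proof -
  have "{(i, j). P i j} = Sigma {i. \<exists>j. P i j} (\<lambda>i. {j. P i j})" by auto
  then show ?thesis using assms by simp
qed

lemma finite_support_fibres':
  assumes "finite {j. \<exists>i. P i j}" and "\<And>j. finite {i. P i j}"
  shows "finite {(i, j). P i j}"
proof -
  have "{(i, j). P i j} = (\<lambda>(j, i). (i, j)) ` {(j, i). P i j}" by auto
  then show ?thesis using finite_support_fibres [of "\<lambda>j i. P i j"] assms by simp
qed

lemma
  assumes "finite {(i, j). P i j}"
  shows finite_row: "finite {j. P i j}" and finite_column: "finite {i. P i j}"
proof -
  have "{j. P i j} \<subseteq> snd ` {(i, j). P i j}" "{i. P i j} \<subseteq> fst ` {(i, j). P i j}"
    by force+
  then show "finite {j. P i j}" "finite {i. P i j}"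
    using assms by (meson finite_imageI finite_subset)+
qed

lemma finite_antidiagonals:
  assumes "finite {n::nat. P n}"
  shows "finite {(i, j). P (i + j)}"
proof -
  obtain N where "\<And>n. P n \<Longrightarrow> n < N"
    using assms finite_nat_set_iff_bounded by auto
  then have "{(i, j). P (i + j)} \<subseteq> {..<N} \<times> {..<N}" by fastforce
  then show ?thesis by (rule finite_subset) simp
qed

abbreviation endomorphism :: "('a::field \<Rightarrow> 'v::ab_group_add \<Rightarrow> 'v) \<Rightarrow> ('v \<Rightarrow> 'v) \<Rightarrow> bool"
  where "endomorphism scale h \<equiv> Vector_Spaces.linear scale scale h"

context vector_space
begin

lemma endomorphismI:
  assumes "\<And>x y. h (x + y) = h x + h y" and "\<And>c x. h (scale c x) = scale c (h x)"
  shows "endomorphism scale h"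
  using assms vector_space_axioms by (simp add: Vector_Spaces.linear_iff)

lemma
  assumes "endomorphism scale h"
  shows endomorphism_add: "h (x + y) = h x + h y"
    and endomorphism_scale: "h (scale c x) = scale c (h x)"
    and endomorphism_zero: "h 0 = 0"
    and endomorphism_diff: "h (x - y) = h x - h y"
proof -
  interpret h: Vector_Spaces.linear scale scale h by (rule assms)
  show "h (x + y) = h x + h y" "h (scale c x) = scale c (h x)" "h 0 = 0"
    "h (x - y) = h x - h y"
    by (rule h.add h.scale h.zero h.diff)+
qed

lemma endomorphism_Sum_any:
  assumes h: "endomorphism scale h" and fin: "finite {i. f i \<noteq> 0}"
  shows "h (Sum_any f) = Sum_any (\<lambda>i. h (f i))"
proof -
  interpret h: Vector_Spaces.linear scale scale h by (rule h)
  have "Sum_any (\<lambda>i. h (f i)) = (\<Sum>i | f i \<noteq> 0. h (f i))"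
    using fin by (intro Sum_any.expand_superset) auto
  then show ?thesis by (simp add: Sum_any.expand_set h.sum)
qed

lemma endomorphism_scale_by: "endomorphism scale (scale c)"
  by (rule endomorphismI) (simp_all add: scale_right_distrib scale_left_commute)

lemma endomorphism_compose:
  assumes "endomorphism scale g" "endomorphism scale h"
  shows "endomorphism scale (\<lambda>x. g (h x))"
  using assms by (intro endomorphismI) (simp_all add: endomorphism_add endomorphism_scale)

lemma endomorphism_Sum_any_family:
  assumes h: "\<And>i. endomorphism scale (h i)" and fin: "\<And>x. finite {i. h i x \<noteq> 0}"
  shows "endomorphism scale (\<lambda>x. Sum_any (\<lambda>i. h i x))"
proof (rule endomorphismI)
  show "Sum_any (\<lambda>i. h i (x + y)) = Sum_any (\<lambda>i. h i x) + Sum_any (\<lambda>i. h i y)" for x y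
    by (simp add: endomorphism_add [OF h] Sum_any.distrib fin)
  show "Sum_any (\<lambda>i. h i (scale c x)) = scale c (Sum_any (\<lambda>i. h i x))" for c x
    by (simp add: endomorphism_scale [OF h] endomorphism_Sum_any [OF endomorphism_scale_by fin])
qed

lemma scale_Sum_any:
  assumes "finite {i. f i \<noteq> 0}"
  shows "scale c (Sum_any f) = Sum_any (\<lambda>i. scale c (f i))"
  by (rule endomorphism_Sum_any [OF endomorphism_scale_by assms])

lemma subspace_Sum_any:
  assumes "subspace S" "\<And>i. f i \<in> S"
  shows "Sum_any f \<in> S"
  using assms by (simp add: Sum_any.expand_set subspace_sum)

lemma endomorphism_image_span:
  assumes h: "endomorphism scale h" and S: "subspace S" and B: "\<And>x. x \<in> B \<Longrightarrow> h x \<in> S"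
    and x: "x \<in> span B"
  shows "h x \<in> S"
proof -
  interpret h: Vector_Spaces.linear scale scale h by (rule h)
  have "subspace {x. h x \<in> S}" by (rule h.subspace_linear_preimage) (rule S)
  then have "span B \<subseteq> {x. h x \<in> S}" by (intro span_minimal) (auto intro: B)
  then show ?thesis using x by auto
qed

lemma bilinear_image_span:
  assumes l: "\<And>y. endomorphism scale (\<lambda>x. h x y)" and r: "\<And>x. endomorphism scale (h x)"
    and S: "subspace S" and B: "\<And>x y. x \<in> B \<Longrightarrow> y \<in> C \<Longrightarrow> h x y \<in> S"
    and x: "x \<in> span B" and y: "y \<in> span C"
  shows "h x y \<in> S"
proof -
  have "h x y \<in> S" if "x \<in> B" for x
    using endomorphism_image_span [OF r S _ y] B that by blast
  then show ?thesis
    using endomorphism_image_span [OF l S _ x] by blast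
qed

lemma finite_support_scale:
  assumes "finite {i. f i \<noteq> 0}"
  shows "finite {i. scale (c i) (f i) \<noteq> 0}"
  by (rule finite_subset [OF _ assms]) auto

lemma Sum_any_scaled_difference:
  assumes A: "finite {i. A i \<noteq> 0}" and B: "finite {i. B i \<noteq> 0}"
  shows "Sum_any (\<lambda>i. scale (c i) (scale e (A i - scale s (B i)))) =
    scale e (Sum_any (\<lambda>i. scale (c i) (A i)) - scale s (Sum_any (\<lambda>i. scale (c i) (B i))))"
proof -
  have fin: "finite {i. scale (f i) (A i) \<noteq> 0}" "finite {i. scale (f i) (B i) \<noteq> 0}" for f
    by (rule finite_support_scale, fact)+
  have "Sum_any (\<lambda>i. scale (c i) (scale e (A i - scale s (B i)))) =
    Sum_any (\<lambda>i. scale (e * c i) (A i) + scale (- e * s * c i) (B i))"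
    by (rule Sum_any.cong) (simp add: scale_right_diff_distrib ac_simps)
  also have "\<dots> = Sum_any (\<lambda>i. scale (e * c i) (A i)) + Sum_any (\<lambda>i. scale (- e * s * c i) (B i))"
    by (rule Sum_any.distrib [OF fin])
  also have "Sum_any (\<lambda>i. scale (e * c i) (A i)) = scale e (Sum_any (\<lambda>i. scale (c i) (A i)))"
    unfolding scale_Sum_any [OF fin(1)] scale_scale ..
  also have "Sum_any (\<lambda>i. scale (- e * s * c i) (B i)) =
    scale (- e * s) (Sum_any (\<lambda>i. scale (c i) (B i)))"
    unfolding scale_Sum_any [OF fin(2)] scale_scale ..
  finally show ?thesis by (simp add: scale_right_diff_distrib)
qed

text \<open>Multiplication of power series: the coefficients of a product are the convolutions.\<close>

lemma Sum_any_convolution: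
  fixes Y :: "nat \<Rightarrow> 'b"
  assumes "finite {n. Y n \<noteq> 0}"
  shows "Sum_any (\<lambda>i. Sum_any (\<lambda>j. scale (\<beta> i j) (Y (i + j)))) =
    Sum_any (\<lambda>n. scale (\<Sum>i\<le>n. \<beta> i (n - i)) (Y n))"
proof -
  obtain N where N: "\<And>n. Y n \<noteq> 0 \<Longrightarrow> n < N"
    using assms finite_nat_set_iff_bounded by auto
  then have Z: "Y n = 0" if "n \<ge> N" for n using that by (meson leD)
  let ?f = "\<lambda>i j. scale (\<beta> i j) (Y (i + j))"
  have inner: "Sum_any (?f i) = (\<Sum>j<N. ?f i j)" for i
    by (rule Sum_any.expand_superset) (use N in fastforce)+
  have "Sum_any (\<lambda>i. Sum_any (?f i)) = (\<Sum>i<N. \<Sum>j<N. ?f i j)"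
    unfolding inner by (rule Sum_any.expand_superset) (auto simp: Z not_le intro: ccontr)
  also have "\<dots> = (\<Sum>(i, j)\<in>{..<N} \<times> {..<N}. ?f i j)"
    by (rule sum.cartesian_product)
  also have "\<dots> = (\<Sum>(i, j)\<in>{(i, j). i + j < N}. ?f i j)"
    by (rule sum.mono_neutral_right) (auto simp: N Z not_less)
  also have "\<dots> = (\<Sum>n<N. \<Sum>i\<le>n. ?f i (n - i))"
    by (rule sum.triangle_reindex)
  also have "\<dots> = (\<Sum>n<N. scale (\<Sum>i\<le>n. \<beta> i (n - i)) (Y n))"
    by (intro sum.cong refl) (simp add: scale_sum_left)
  also have "\<dots> = Sum_any (\<lambda>n. scale (\<Sum>i\<le>n. \<beta> i (n - i)) (Y n))"
    by (rule Sum_any.expand_superset [symmetric]) (use N in fastforce)+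
  finally show ?thesis .
qed

lemma Sum_any_index_shift:
  fixes Z :: "nat \<Rightarrow> 'b"
  assumes fin: "finite {n. Z n \<noteq> 0}" and c: "\<And>m. m < i \<Longrightarrow> c m = 0"
  shows "Sum_any (\<lambda>m. scale (c m) (Z m)) = Sum_any (\<lambda>m. scale (c (m + i)) (Z (m + i)))"
  using fin c
proof (induction i arbitrary: c Z)
  case (Suc i)
  have fin': "finite {n. Z (Suc n) \<noteq> 0}"
    using finite_vimageI [OF Suc.prems(1), of Suc] by (simp add: vimage_def)
  have "Sum_any (\<lambda>m. scale (c m) (Z m)) = Sum_any (\<lambda>m. scale (c (Suc m)) (Z (Suc m)))"
    using Sum_any_Suc_shift [OF finite_support_scale [OF Suc.prems(1), of c]] Suc.prems(2) [of 0]
    by simp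
  also have "\<dots> = Sum_any (\<lambda>m. scale (c (Suc (m + i))) (Z (Suc (m + i))))"
    by (rule Suc.IH [OF fin', of "\<lambda>m. c (Suc m)"]) (simp add: Suc.prems)
  finally show ?case by simp
qed simp

section \<open>Components along a direct sum\<close>

context
  fixes I :: "'i set" and G :: "'i \<Rightarrow> 'b set"
  assumes ds: "internal_direct_sum I G"
begin

lemma summand_subspace: "i \<in> I \<Longrightarrow> subspace (G i)"
  using ds by (simp add: internal_direct_sum_def)

lemma decomposes_component: "decomposes I G v (component I G v)"
  unfolding component_def using ds unfolding internal_direct_sum_def by (metis theI')

lemma component_unique: "decomposes I G v f \<Longrightarrow> component I G v = f"
  using decomposes_component ds unfolding internal_direct_sum_def by blast

lemma component_mem: "i \<in> I \<Longrightarrow> component I G v i \<in> G i"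
  using decomposes_component by (simp add: decomposes_def)

lemma component_outside: "i \<notin> I \<Longrightarrow> component I G v i = 0"
  using decomposes_component by (simp add: decomposes_def)

lemma finite_component: "finite {i. component I G v i \<noteq> 0}"
  using decomposes_component by (simp add: decomposes_def)

lemma Sum_any_component: "Sum_any (component I G v) = v"
  using decomposes_component [of v] by (simp add: decomposes_def)

lemma component_summand:
  assumes "i \<in> I" "v \<in> G i"
  shows "component I G v = (\<lambda>j. if j = i then v else 0)"
  using assms summand_subspace by (intro component_unique) (auto simp: decomposes_def subspace_0)

text \<open>
  The images of the components again form a decomposition, and decompositions are unique. This is how
  a degree-preserving operator is shown to commute with the projection to a degree.
\<close>

lemma component_commutes:
  assumes h: "endomorphism scale h" and G: "\<And>i x. i \<in> I \<Longrightarrow> x \<in> G i \<Longrightarrow> h x \<in> G i"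
  shows "component I G (h v) = (\<lambda>i. h (component I G v i))"
proof (rule component_unique)
  show "decomposes I G (h v) (\<lambda>i. h (component I G v i))"
    unfolding decomposes_def
  proof (intro conjI allI ballI impI)
    show "finite {i. h (component I G v i) \<noteq> 0}"
      by (rule finite_subset [OF _ finite_component [of v]]) (auto simp: endomorphism_zero [OF h])
    show "h v = Sum_any (\<lambda>i. h (component I G v i))"
      by (simp add: endomorphism_Sum_any [OF h finite_component, symmetric] Sum_any_component)
  qed (simp_all add: G component_mem component_outside endomorphism_zero [OF h])
qed

lemma component_endomorphism: "endomorphism scale (\<lambda>v. component I G v i)"
proof (rule endomorphismI)
  fix v w c
  have "decomposes I G (v + w) (\<lambda>i. component I G v i + component I G w i)"
    unfolding decomposes_def
  proof (intro conjI allI ballI impI)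
    show "finite {i. component I G v i + component I G w i \<noteq> 0}"
      by (rule finite_subset [OF _ finite_UnI [OF finite_component [of v] finite_component [of w]]])
        auto
    show "v + w = Sum_any (\<lambda>i. component I G v i + component I G w i)"
      by (simp add: Sum_any.distrib finite_component Sum_any_component)
  qed (simp_all add: component_mem component_outside subspace_add summand_subspace)
  then show "component I G (v + w) i = component I G v i + component I G w i"
    by (simp add: component_unique)
  have "decomposes I G (scale c v) (\<lambda>i. scale c (component I G v i))"
    unfolding decomposes_def
  proof (intro conjI allI ballI impI)
    show "scale c v = Sum_any (\<lambda>i. scale c (component I G v i))"
      by (simp add: scale_Sum_any [symmetric] finite_component Sum_any_component)
  qed (simp_all add: component_mem component_outside subspace_scale summand_subspace
      finite_support_scale finite_component)
  then show "component I G (scale c v) i = scale c (component I G v i)"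
    by (simp add: component_unique)
qed

end

end

section \<open>Residues of vertex operators\<close>

lemma gbinomial_revision:
  fixes a :: "'a::field_char_0"
  shows "(a gchoose (m + i)) * (of_nat (m + i) gchoose i) = (a gchoose i) * ((a - of_nat i) gchoose m)"
  using gbinomial_trinomial_revision [of i "m + i" a] by simp

context dg_vertex_algebra
begin

lemmas mode_left [simp] =
  endomorphism_add [OF mode_linear_left] endomorphism_scale [OF mode_linear_left]
  endomorphism_zero [OF mode_linear_left] endomorphism_diff [OF mode_linear_left]

lemmas mode_right [simp] =
  endomorphism_add [OF mode_linear_right] endomorphism_scale [OF mode_linear_right]
  endomorphism_zero [OF mode_linear_right] endomorphism_diff [OF mode_linear_right]

lemmas d_simps [simp] =
  endomorphism_add [OF d_linear] endomorphism_scale [OF d_linear]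
  endomorphism_zero [OF d_linear] endomorphism_diff [OF d_linear]

lemma finite_modes [simp]: "finite {n::nat. mode u (int n + k) v \<noteq> 0}"
proof -
  obtain N where "\<And>n. n \<ge> N \<Longrightarrow> mode u n v = 0" using truncation by blast
  then have "n < nat (N - k)" if "mode u (int n + k) v \<noteq> 0" for n
    using that by (smt (verit) nat_le_eq_zle nat_less_iff zless_nat_eq_int_zless)
  then have "{n::nat. mode u (int n + k) v \<noteq> 0} \<subseteq> {..<nat (N - k)}" by auto
  then show ?thesis by (rule finite_subset) simp
qed

text \<open>
  This is $\mathrm{Res}_x\, (1+x)^a x^k\, Y(u,x)v$. The exponent \<open>a\<close> is a free parameter rather than the
  weight of \<open>u\<close>, so that identities which shift it by integers can be stated without mentioning
  weights.
\<close>

definition residue :: "complex \<Rightarrow> int \<Rightarrow> 'v \<Rightarrow> 'v \<Rightarrow> 'v"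
  where "residue a k u v = Sum_any (\<lambda>n::nat. (a gchoose n) *s mode u (int n + k) v)"

lemma finite_residue_terms: "finite {n::nat. (c n) *s mode u (int n + k) v \<noteq> 0}"
  by (rule finite_support_scale) (rule finite_modes)

lemma residue_linear_left: "endomorphism scale (\<lambda>u. residue a k u v)"
  unfolding residue_def
  by (rule endomorphism_Sum_any_family)
    (auto intro!: endomorphism_compose [OF endomorphism_scale_by] mode_linear_left)

lemma residue_linear_right: "endomorphism scale (residue a k u)"
proof -
  have "endomorphism scale (\<lambda>v. residue a k u v)"
    unfolding residue_def
    by (rule endomorphism_Sum_any_family)
      (auto intro!: endomorphism_compose [OF endomorphism_scale_by] mode_linear_right)
  then show ?thesis by simp
qed

lemmas residue_left [simp] =
  endomorphism_add [OF residue_linear_left] endomorphism_scale [OF residue_linear_left]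
  endomorphism_zero [OF residue_linear_left] endomorphism_diff [OF residue_linear_left]

lemmas residue_right [simp] =
  endomorphism_add [OF residue_linear_right] endomorphism_scale [OF residue_linear_right]
  endomorphism_zero [OF residue_linear_right] endomorphism_diff [OF residue_linear_right]

lemma residue_eq_0: "(\<And>n::nat. mode u (int n + k) v = 0) \<Longrightarrow> residue a k u v = 0"
  by (simp add: residue_def)

lemma finite_residues: "finite {j::nat. residue (a j) (int j + k) u v \<noteq> 0}"
proof -
  obtain N where N: "\<And>n. n \<ge> N \<Longrightarrow> mode u n v = 0" using truncation by blast
  have "residue (a j) (int j + k) u v = 0" if "j \<ge> nat (N - k)" for j
    using that by (intro residue_eq_0 N) linarith
  then have "{j::nat. residue (a j) (int j + k) u v \<noteq> 0} \<subseteq> {..<nat (N - k)}"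
    by (auto simp: not_less [symmetric])
  then show ?thesis by (rule finite_subset) simp
qed

text \<open>
  Multiplying by $1 + x$ raises the exponent by one.
\<close>

lemma residue_pascal: "residue (a + 1) k u v = residue a k u v + residue a (k + 1) u v"
proof -
  let ?X = "\<lambda>n::nat. mode u (int n + k) v"
  have fin: "finite {n. c n *s ?X (Suc n) \<noteq> 0}" for c
    using finite_residue_terms [of c u "k + 1" v] by (simp add: algebra_simps)
  have *: "residue b k u v = ?X 0 + Sum_any (\<lambda>n. (b gchoose Suc n) *s ?X (Suc n))" for b
    unfolding residue_def by (subst Sum_any_Suc_shift) (simp_all add: finite_residue_terms)
  have "residue a (k + 1) u v = Sum_any (\<lambda>n. (a gchoose n) *s ?X (Suc n))"
    unfolding residue_def by (simp add: algebra_simps)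
  then show ?thesis
    unfolding * [of a] * [of "a + 1"] gbinomial_Suc_Suc scale_left_distrib Sum_any.distrib [OF fin fin]
    by (simp only: ac_simps)
qed

text \<open>
  Multiplying by $(1+x)^b = \sum_j \binom bj x^j$ adds \<open>b\<close> to the exponent; the coefficients agree by
  Vandermonde's identity.
\<close>

lemma residue_convolution:
  "Sum_any (\<lambda>j::nat. (b gchoose j) *s residue c (int j + k) u v) = residue (c + b) k u v"
proof -
  let ?Y = "\<lambda>n::nat. mode u (int n + k) v"
  have "Sum_any (\<lambda>j::nat. (b gchoose j) *s residue c (int j + k) u v) =
    Sum_any (\<lambda>j::nat. Sum_any (\<lambda>n. ((b gchoose j) * (c gchoose n)) *s ?Y (j + n)))"
    unfolding residue_def
    by (subst scale_Sum_any [OF finite_residue_terms]) (simp add: algebra_simps)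
  also have "\<dots> = Sum_any (\<lambda>n. (\<Sum>j\<le>n. (b gchoose j) * (c gchoose (n - j))) *s ?Y n)"
    by (rule Sum_any_convolution) (rule finite_modes)
  also have "\<dots> = residue (c + b) k u v"
    unfolding residue_def
    by (simp add: atMost_atLeast0 gbinomial_Vandermonde add.commute)
  finally show ?thesis .
qed

text \<open>
  The $i$-th divided derivative of $(1+x)^a$ is $\binom ai (1+x)^{a-i}$. Such derivatives come from the
  right-hand side of the Jacobi identity, where $\binom mi$ multiplies the coefficient of index $m$.
\<close>

lemma residue_shifted:
  "Sum_any (\<lambda>m::nat. ((a gchoose m) * (of_nat m gchoose i)) *s mode u (int m + n - int i) w) =
   (a gchoose i) *s residue (a - of_nat i) n u w"
proof -
  have fin: "finite {m::nat. mode u (int m + n - int i) w \<noteq> 0}"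
    using finite_modes [of u "n - int i" w] by (simp add: algebra_simps)
  have "Sum_any (\<lambda>m::nat. ((a gchoose m) * (of_nat m gchoose i)) *s mode u (int m + n - int i) w) =
    Sum_any (\<lambda>m. ((a gchoose (m + i)) * (of_nat (m + i) gchoose i)) *s
      mode u (int (m + i) + n - int i) w)"
    using fin by (rule Sum_any_index_shift) (simp add: binomial_gbinomial [symmetric])
  also have "\<dots> = Sum_any (\<lambda>m. (a gchoose i) *s ((a - of_nat i) gchoose m) *s mode u (int m + n) w)"
    by (simp only: gbinomial_revision) simp
  also have "\<dots> = (a gchoose i) *s residue (a - of_nat i) n u w"
    unfolding residue_def by (rule scale_Sum_any [symmetric]) (rule finite_residue_terms)
  finally show ?thesis .
qed

text \<open>
  The Jacobi identities with fixed \<open>l\<close> and \<open>n\<close>, weighted by $\binom am$ and added up over $m \ge 0$: this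
  inserts the factor $(1+x)^a$ into the vertex operator of \<open>u\<close>. All double sums have finite support by
  truncation, which allows the sums over \<open>m\<close> and \<open>i\<close> to be exchanged.
\<close>

lemma borcherds_residue_left:
  assumes u: "u \<in> deg p" and v: "v \<in> deg q"
  shows "Sum_any (\<lambda>i::nat. ((-1) ^ i * (of_int l gchoose i)) *s
      (residue a (l - int i) u (mode v (n + int i) w)
        - ((-1) powi l * (-1) powi (p * q)) *s mode v (n + l - int i) (residue a (int i) u w))) =
    Sum_any (\<lambda>i. (a gchoose i) *s residue (a - of_nat i) n (mode u (l + int i) v) w)"
proof -
  define \<epsilon> :: "nat \<Rightarrow> complex" where "\<epsilon> i = (-1) ^ i * (of_int l gchoose i)" for i
  define s :: complex where "s = (-1) powi l * (-1) powi (p * q)"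
  let ?A = "\<lambda>m i. mode u (int m + l - int i) (mode v (n + int i) w)"
  let ?B = "\<lambda>m i. mode v (n + l - int i) (mode u (int m + int i) w)"
  let ?C = "\<lambda>m i. mode (mode u (l + int i) v) (int m + n - int i) w"
  have finA': "finite {m. ?A m i \<noteq> 0}" for i
    using finite_modes [of u "l - int i" "mode v (n + int i) w"] by (simp add: algebra_simps)
  have finB': "finite {m. ?B m i \<noteq> 0}" for i
    by (rule finite_subset [OF _ finite_modes [of u "int i" w]]) auto
  have finA: "finite {(m, i). ?A m i \<noteq> 0}"
  proof (rule finite_support_fibres')
    show "finite {i. \<exists>m. ?A m i \<noteq> 0}"
      by (rule finite_subset [OF _ finite_modes [of v n w]]) (auto simp: add.commute)
  qed (rule finA')
  have finB: "finite {(m, i). ?B m i \<noteq> 0}"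
    by (rule finite_subset [OF _ finite_antidiagonals [OF finite_modes [of u 0 w]]]) auto
  have finC: "finite {(m, i). ?C m i \<noteq> 0}"
  proof (rule finite_support_fibres')
    show "finite {i. \<exists>m. ?C m i \<noteq> 0}"
      by (rule finite_subset [OF _ finite_modes [of u l v]]) (auto simp: add.commute)
    show "finite {m. ?C m i \<noteq> 0}" for i
      using finite_modes [of "mode u (l + int i) v" "n - int i" w] by (simp add: algebra_simps)
  qed
  have fin: "finite {i. ?A m i - s *s ?B m i \<noteq> 0}" "finite {i. ?C m i \<noteq> 0}" for m
  proof -
    show "finite {i. ?A m i - s *s ?B m i \<noteq> 0}"
      using finite_UnI [OF finite_row [OF finA, of m] finite_row [OF finB, of m]]
      by (rule finite_subset [rotated]) auto
    show "finite {i. ?C m i \<noteq> 0}"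
      by (rule finite_row [OF finC])
  qed
  have J: "Sum_any (\<lambda>i. \<epsilon> i *s (?A m i - s *s ?B m i)) = Sum_any (\<lambda>i. (of_nat m gchoose i) *s ?C m i)" for m
    using jacobi [OF u v, of l "int m" n w] by (simp add: \<epsilon>_def s_def)
  have "Sum_any (\<lambda>m. (a gchoose m) *s Sum_any (\<lambda>i. \<epsilon> i *s (?A m i - s *s ?B m i))) =
    Sum_any (\<lambda>m. Sum_any (\<lambda>i. (a gchoose m) *s \<epsilon> i *s (?A m i - s *s ?B m i)))"
    by (subst scale_Sum_any [OF finite_support_scale [OF fin(1)]]) simp
  also have "\<dots> = Sum_any (\<lambda>i. Sum_any (\<lambda>m. (a gchoose m) *s \<epsilon> i *s (?A m i - s *s ?B m i)))"
    by (rule Sum_any_swap, rule finite_subset [OF _ finite_UnI [OF finA finB]]) auto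
  also have "\<dots> = Sum_any (\<lambda>i. \<epsilon> i *s
      (residue a (l - int i) u (mode v (n + int i) w)
        - s *s mode v (n + l - int i) (residue a (int i) u w)))"
  proof (rule Sum_any.cong)
    fix i
    have A: "residue a (l - int i) u (mode v (n + int i) w) = Sum_any (\<lambda>m. (a gchoose m) *s ?A m i)"
      unfolding residue_def by (simp add: algebra_simps)
    have B: "mode v (n + l - int i) (residue a (int i) u w) = Sum_any (\<lambda>m. (a gchoose m) *s ?B m i)"
      unfolding residue_def
      by (subst endomorphism_Sum_any [OF mode_linear_right finite_residue_terms]) simp
    show "Sum_any (\<lambda>m. (a gchoose m) *s \<epsilon> i *s (?A m i - s *s ?B m i)) =
      \<epsilon> i *s (residue a (l - int i) u (mode v (n + int i) w)
        - s *s mode v (n + l - int i) (residue a (int i) u w))"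
      unfolding A B by (rule Sum_any_scaled_difference) (rule finA' finB')+
  qed
  finally have L: "Sum_any (\<lambda>m. (a gchoose m) *s Sum_any (\<lambda>i. \<epsilon> i *s (?A m i - s *s ?B m i))) = \<dots>" .
  have "Sum_any (\<lambda>m. (a gchoose m) *s Sum_any (\<lambda>i. (of_nat m gchoose i) *s ?C m i)) =
    Sum_any (\<lambda>m. Sum_any (\<lambda>i. ((a gchoose m) * (of_nat m gchoose i)) *s ?C m i))"
    by (subst scale_Sum_any [OF finite_support_scale [OF fin(2)]]) simp
  also have "\<dots> = Sum_any (\<lambda>i. Sum_any (\<lambda>m. ((a gchoose m) * (of_nat m gchoose i)) *s ?C m i))"
    by (rule Sum_any_swap, rule finite_subset [OF _ finC]) auto
  also have "\<dots> = Sum_any (\<lambda>i. (a gchoose i) *s residue (a - of_nat i) n (mode u (l + int i) v) w)"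
    by (simp only: residue_shifted)
  finally have R: "Sum_any (\<lambda>m. (a gchoose m) *s Sum_any (\<lambda>i. (of_nat m gchoose i) *s ?C m i)) = \<dots>" .
  show ?thesis by (rule L [unfolded J R, symmetric, unfolded \<epsilon>_def s_def])
qed

text \<open>
  The factor $(1+x)^b$ is inserted into the vertex operator of \<open>v\<close> in the same way, by weighting
  \<open>borcherds_residue_left\<close> at $n = j + k$ with $\binom bj$. In terms of formal series this is the Jacobi
  identity multiplied by $(1+x_1)^a (1+x_2)^b$ and a monomial, where on the right-hand side
  $1 + x_1 = (1 + x_2) + x_0$ is expanded in powers of $x_0$.
\<close>

lemma borcherds_residue:
  assumes u: "u \<in> deg p" and v: "v \<in> deg q"
  shows "Sum_any (\<lambda>i::nat. ((-1) ^ i * (of_int l gchoose i)) *s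
      (residue a (l - int i) u (residue b (k + int i) v w)
        - ((-1) powi l * (-1) powi (p * q)) *s residue b (k + l - int i) v (residue a (int i) u w))) =
    Sum_any (\<lambda>i. (a gchoose i) *s residue (a + b - of_nat i) k (mode u (l + int i) v) w)"
proof -
  define \<epsilon> :: "nat \<Rightarrow> complex" where "\<epsilon> i = (-1) ^ i * (of_int l gchoose i)" for i
  define s :: complex where "s = (-1) powi l * (-1) powi (p * q)"
  let ?A = "\<lambda>j i. residue a (l - int i) u (mode v (int j + k + int i) w)"
  let ?B = "\<lambda>j i. mode v (int j + k + l - int i) (residue a (int i) u w)"
  let ?C = "\<lambda>j i. residue (a - of_nat i) (int j + k) (mode u (l + int i) v) w"
  have finA: "finite {(j, i). ?A j i \<noteq> 0}"
    by (rule finite_subset [OF _ finite_antidiagonals [OF finite_modes [of v k w]]])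
      (auto simp: algebra_simps)
  have finB: "finite {(j, i). ?B j i \<noteq> 0}"
  proof (rule finite_support_fibres')
    show "finite {i. \<exists>j. ?B j i \<noteq> 0}"
      by (rule finite_subset [OF _ finite_residues [of "\<lambda>_. a" 0 u w]]) auto
    show "finite {j. ?B j i \<noteq> 0}" for i
      using finite_modes [of v "k + l - int i" "residue a (int i) u w"] by (simp add: algebra_simps)
  qed
  have finC: "finite {(j, i). ?C j i \<noteq> 0}"
  proof (rule finite_support_fibres')
    show "finite {i. \<exists>j. ?C j i \<noteq> 0}"
      by (rule finite_subset [OF _ finite_modes [of u l v]]) (auto simp: add.commute)
  qed (rule finite_residues)
  have fin: "finite {i. ?A j i - s *s ?B j i \<noteq> 0}" "finite {i. ?C j i \<noteq> 0}"
    "finite {j'. ?A j' j \<noteq> 0}" "finite {j'. ?B j' j \<noteq> 0}" for j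
  proof -
    show "finite {i. ?A j i - s *s ?B j i \<noteq> 0}"
      using finite_UnI [OF finite_row [OF finA, of j] finite_row [OF finB, of j]]
      by (rule finite_subset [rotated]) auto
    show "finite {i. ?C j i \<noteq> 0}"
      by (rule finite_row [OF finC])
    show "finite {j'. ?A j' j \<noteq> 0}"
      by (rule finite_column [OF finA])
    show "finite {j'. ?B j' j \<noteq> 0}"
      by (rule finite_column [OF finB])
  qed
  have J: "Sum_any (\<lambda>i. \<epsilon> i *s (?A j i - s *s ?B j i)) = Sum_any (\<lambda>i. (a gchoose i) *s ?C j i)" for j
    using borcherds_residue_left [OF u v, of l a "int j + k" w] by (simp add: \<epsilon>_def s_def)
  have "Sum_any (\<lambda>j. (b gchoose j) *s Sum_any (\<lambda>i. \<epsilon> i *s (?A j i - s *s ?B j i))) =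
    Sum_any (\<lambda>j. Sum_any (\<lambda>i. (b gchoose j) *s \<epsilon> i *s (?A j i - s *s ?B j i)))"
    by (subst scale_Sum_any [OF finite_support_scale [OF fin(1)]]) simp
  also have "\<dots> = Sum_any (\<lambda>i. Sum_any (\<lambda>j. (b gchoose j) *s \<epsilon> i *s (?A j i - s *s ?B j i)))"
    by (rule Sum_any_swap, rule finite_subset [OF _ finite_UnI [OF finA finB]]) auto
  also have "\<dots> = Sum_any (\<lambda>i. \<epsilon> i *s
      (residue a (l - int i) u (residue b (k + int i) v w)
        - s *s residue b (k + l - int i) v (residue a (int i) u w)))"
  proof (rule Sum_any.cong)
    fix i
    have A: "residue a (l - int i) u (residue b (k + int i) v w) = Sum_any (\<lambda>j. (b gchoose j) *s ?A j i)"
      unfolding residue_def [of b]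
      by (subst endomorphism_Sum_any [OF residue_linear_right finite_residue_terms])
        (simp add: algebra_simps)
    have B: "residue b (k + l - int i) v (residue a (int i) u w) = Sum_any (\<lambda>j. (b gchoose j) *s ?B j i)"
      unfolding residue_def [of b] by (simp add: algebra_simps)
    show "Sum_any (\<lambda>j. (b gchoose j) *s \<epsilon> i *s (?A j i - s *s ?B j i)) =
      \<epsilon> i *s (residue a (l - int i) u (residue b (k + int i) v w)
        - s *s residue b (k + l - int i) v (residue a (int i) u w))"
      unfolding A B by (rule Sum_any_scaled_difference) (rule fin)+
  qed
  finally have L: "Sum_any (\<lambda>j. (b gchoose j) *s Sum_any (\<lambda>i. \<epsilon> i *s (?A j i - s *s ?B j i))) = \<dots>" .
  have "Sum_any (\<lambda>j. (b gchoose j) *s Sum_any (\<lambda>i. (a gchoose i) *s ?C j i)) =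
    Sum_any (\<lambda>j. Sum_any (\<lambda>i. (a gchoose i) *s (b gchoose j) *s ?C j i))"
    by (subst scale_Sum_any [OF finite_support_scale [OF fin(2)]]) (simp add: mult.commute)
  also have "\<dots> = Sum_any (\<lambda>i. Sum_any (\<lambda>j. (a gchoose i) *s (b gchoose j) *s ?C j i))"
    by (rule Sum_any_swap, rule finite_subset [OF _ finC]) auto
  also have "\<dots> = Sum_any (\<lambda>i. (a gchoose i) *s residue (a + b - of_nat i) k (mode u (l + int i) v) w)"
    by (subst scale_Sum_any [OF finite_support_scale [OF finite_residues], symmetric])
      (simp add: residue_convolution diff_add_eq)
  finally have R: "Sum_any (\<lambda>j. (b gchoose j) *s Sum_any (\<lambda>i. (a gchoose i) *s ?C j i)) = \<dots>" .
  show ?thesis by (rule L [unfolded J R, symmetric, unfolded \<epsilon>_def s_def])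
qed

end

section \<open>Translation and weights\<close>

lemma gbinomial_minus_two: "(-1) ^ i * ((- 2) gchoose i) = (of_nat (Suc i) :: 'a::field_char_0)"
proof -
  have "((- 2) gchoose i) = (-1) ^ i * (of_nat (Suc i) gchoose i :: 'a)"
    using gbinomial_minus [of "2::'a" i] by (simp add: algebra_simps)
  also have "(of_nat (Suc i) gchoose i :: 'a) = of_nat (Suc i)"
    unfolding binomial_gbinomial [symmetric] by simp
  finally show ?thesis by (simp del: of_nat_Suc)
qed

context dg_vertex_algebra
begin

text \<open>
  The $L(-1)$-derivative property, obtained from the Jacobi identity for \<open>u\<close> and the vacuum with
  $l = -2$ and $m = 0$: the vacuum has only one nonzero mode, so at most one term survives.
\<close>

lemma mode_translation:
  assumes u: "u \<in> deg p"
  shows "mode (mode u (-2) vac) n w = - (of_int n *s mode u (n - 1) w)"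
proof -
  let ?f = "\<lambda>i::nat. of_nat (Suc i) *s
    (mode u (-2 - int i) (mode vac (n + int i) w) - mode vac (n - 2 - int i) (mode u (int i) w))"
  have "mode (mode u (-2) vac) n w =
    Sum_any (\<lambda>i::nat. (of_int 0 gchoose i) *s mode (mode u (-2 + int i) vac) (0 + n - int i) w)"
    by (subst Sum_any_only_zero) (auto simp: gbinomial_0_left)
  also have "\<dots> = Sum_any (\<lambda>i::nat. ((-1) ^ i * (of_int (-2) gchoose i)) *s
    (mode u (0 + -2 - int i) (mode vac (n + int i) w) -
      ((-1) powi (-2) * (-1) powi (p * 0)) *s mode vac (n + -2 - int i) (mode u (0 + int i) w)))"
    by (rule jacobi [OF u vac_deg, symmetric])
  also have "\<dots> = Sum_any ?f"
  proof (rule Sum_any.cong)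
    fix i
    have "(-1) ^ i * (of_int (-2) gchoose i) = (of_nat (Suc i) :: complex)"
      using gbinomial_minus_two [of i] by simp
    then show "((-1) ^ i * (of_int (-2) gchoose i)) *s
      (mode u (0 + -2 - int i) (mode vac (n + int i) w) -
        ((-1) powi (-2) * (-1) powi (p * 0)) *s mode vac (n + -2 - int i) (mode u (0 + int i) w)) = ?f i"
      by (simp only:) (simp add: power_int_minus)
  qed
  also have "\<dots> = - (of_int n *s mode u (n - 1) w)"
  proof (cases "n < 0")
    case True
    define j where "j = nat (- 1 - n)"
    have j: "int j = - 1 - n" using True by (simp add: j_def)
    have "?f i = 0" if "i \<noteq> j" for i
    proof -
      have "n + int i \<noteq> -1" "n - 2 - int i \<noteq> -1" using True j that by linarith+
      then show ?thesis by (simp add: vac_mode)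
    qed
    then have "Sum_any ?f = sum ?f {j}"
      by (intro Sum_any.expand_superset) blast+
    also have "\<dots> = of_nat (Suc j) *s mode u (n - 1) w"
      using True j by (simp add: vac_mode)
    also have "(of_nat (Suc j) :: complex) = of_int (- n)"
    proof -
      have "int (Suc j) = - n" using j by simp
      then show ?thesis by (metis of_int_of_nat_eq)
    qed
    finally show ?thesis by simp
  next
    case False
    show ?thesis
    proof (cases "n = 0")
      case True
      then have "?f = (\<lambda>i. 0)" by (auto simp: vac_mode)
      then show ?thesis using True by (simp only: Sum_any.neutral) simp
    next
      case n: False
      define j where "j = nat (n - 1)"
      have j: "int j = n - 1" using False n by (simp add: j_def)
      have "?f i = 0" if "i \<noteq> j" for i
      proof -
        have "n + int i \<noteq> -1" "n - 2 - int i \<noteq> -1" using False n j that by linarith+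
        then show ?thesis by (simp add: vac_mode)
      qed
      then have "Sum_any ?f = sum ?f {j}"
        by (intro Sum_any.expand_superset) blast+
      also have "\<dots> = - (of_nat (Suc j) *s mode u (n - 1) w)"
        using False n j by (simp add: vac_mode)
      also have "(of_nat (Suc j) :: complex) = of_int n"
      proof -
        have "int (Suc j) = n" using j by simp
        then show ?thesis by (metis of_int_of_nat_eq)
      qed
      finally show ?thesis .
    qed
  qed
  finally show ?thesis .
qed

text \<open>
  Integration by parts: the residue of a derivative vanishes, and
  $\frac{d}{dx}\left((1+x)^{b+1}x^k\right) = k(1+x)^{b+1}x^{k-1} + (b+1)(1+x)^b x^k$.
\<close>

lemma residue_translation:
  assumes u: "u \<in> deg p"
  shows "residue (b + 1) k (mode u (-2) vac) v =
    - (of_int k *s residue (b + 1) (k - 1) u v) - (b + 1) *s residue b k u v"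
proof -
  let ?X = "\<lambda>n::nat. mode u (int n + (k - 1)) v"
  have fin: "finite {n. c n *s ?X n \<noteq> 0}" for c by (rule finite_residue_terms)
  have fin': "finite {n. c n *s ?X (Suc n) \<noteq> 0}" for c
    using finite_residue_terms [of c u k v] by (simp add: algebra_simps)
  have 1: "Sum_any (\<lambda>n. (of_nat n * ((b + 1) gchoose n)) *s ?X n) = (b + 1) *s residue b k u v"
  proof -
    have "Sum_any (\<lambda>n. (of_nat n * ((b + 1) gchoose n)) *s ?X n) =
      Sum_any (\<lambda>n. (of_nat (Suc n) * ((b + 1) gchoose Suc n)) *s ?X (Suc n))"
      by (subst Sum_any_Suc_shift [OF fin]) simp
    also have "\<dots> = Sum_any (\<lambda>n. (b + 1) *s (b gchoose n) *s ?X (Suc n))"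
      unfolding Suc_times_gbinomial by simp
    also have "\<dots> = (b + 1) *s Sum_any (\<lambda>n. (b gchoose n) *s ?X (Suc n))"
      by (rule scale_Sum_any [OF fin', symmetric])
    also have "Sum_any (\<lambda>n. (b gchoose n) *s ?X (Suc n)) = residue b k u v"
      unfolding residue_def by (simp add: algebra_simps)
    finally show ?thesis .
  qed
  have "residue (b + 1) k (mode u (-2) vac) v =
    Sum_any (\<lambda>n. (- of_int k) *s ((b + 1) gchoose n) *s ?X n
      + (-1) *s (of_nat n * ((b + 1) gchoose n)) *s ?X n)"
    unfolding residue_def mode_translation [OF u]
    by (intro Sum_any.cong) (simp add: algebra_simps)
  also have "\<dots> = Sum_any (\<lambda>n. (- of_int k) *s ((b + 1) gchoose n) *s ?X n)
      + Sum_any (\<lambda>n. (-1) *s (of_nat n * ((b + 1) gchoose n)) *s ?X n)"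
    by (rule Sum_any.distrib) (unfold scale_scale, rule fin, rule fin)
  also have "\<dots> = (- of_int k) *s residue (b + 1) (k - 1) u v + (-1) *s ((b + 1) *s residue b k u v)"
    unfolding residue_def [of "b + 1"] 1 [symmetric]
    by (simp only: scale_Sum_any [OF fin])
  finally show ?thesis
    by (simp only: scale_minus_left scale_one diff_conv_add_uminus)
qed

end

lemma half_integers_shift: "a \<in> half_integers \<Longrightarrow> a + of_int n \<in> half_integers"
  by (auto simp: half_integers_def distrib_left)

lemma half_integers_add: "a \<in> half_integers \<Longrightarrow> b \<in> half_integers \<Longrightarrow> a + b \<in> half_integers"
  by (simp add: half_integers_def distrib_left)

lemma half_integers_of_int: "of_int n \<in> half_integers"
  by (simp add: half_integers_def)

context dg_vertex_operator_algebra
begin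

lemma weight_space_iff: "v \<in> weight_space \<omega> a \<longleftrightarrow> mode \<omega> 1 v = complex_of_real a *s v"
  by (simp add: weight_space_def L_def)

text \<open>
  The commutator of $L(0) = \omega_1$ with $u_n$ is $(L(-1)u)_{n+1} + (L(0)u)_n$, by the Jacobi identity for
  \<open>\<omega>\<close> and \<open>u\<close> with $l = 0$ and $m = 1$; the even degree of \<open>\<omega>\<close> makes the sign trivial.
\<close>

lemma mode_weight:
  assumes u: "u \<in> deg p" "u \<in> weight_space \<omega> a" and v: "v \<in> weight_space \<omega> b"
  shows "mode u n v \<in> weight_space \<omega> (a + b - of_int n - 1)"
proof -
  have [simp]: "mode \<omega> 1 u = complex_of_real a *s u" "mode \<omega> 1 v = complex_of_real b *s v"
    using u v by (simp_all add: weight_space_iff)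
  have 0: "mode \<omega> 0 u = mode u (-2) vac"
    using L_minus_one [of u] by (simp add: L_def)
  have "mode \<omega> 1 (mode u n v) - mode u n (mode \<omega> 1 v) =
    Sum_any (\<lambda>i::nat. ((-1) ^ i * (of_int 0 gchoose i)) *s
      (mode \<omega> (1 + 0 - int i) (mode u (n + int i) v)
        - ((-1) powi 0 * (-1) powi (4 * p)) *s mode u (n + 0 - int i) (mode \<omega> (1 + int i) v)))"
    by (subst Sum_any_only_zero) (auto simp: gbinomial_0_left power_int_mult)
  also have "\<dots> = Sum_any (\<lambda>i::nat. (of_int 1 gchoose i) *s mode (mode \<omega> (0 + int i) u) (1 + n - int i) v)"
    by (rule jacobi [OF conformal_deg u(1)])
  also have "\<dots> = (\<Sum>i\<in>{0, 1::nat}. (of_int 1 gchoose i) *s mode (mode \<omega> (0 + int i) u) (1 + n - int i) v)"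
  proof (rule Sum_any.expand_superset)
    have "(1 gchoose i :: complex) = 0" if "i \<noteq> 0" "i \<noteq> 1" for i
    proof -
      have "(1::nat) choose i = 0" using that by (intro binomial_eq_0) simp
      then show ?thesis by (metis binomial_gbinomial of_nat_0 of_nat_1)
    qed
    then show "{i. (of_int 1 gchoose i) *s mode (mode \<omega> (0 + int i) u) (1 + n - int i) v \<noteq> 0} \<subseteq> {0, 1}"
      by auto
  qed simp
  also have "\<dots> = (of_real a - of_int (n + 1)) *s mode u n v"
    by (simp add: 0 mode_translation [OF u(1)] scale_left_diff_distrib add.commute)
  finally have "mode \<omega> 1 (mode u n v) = of_real b *s mode u n v + (of_real a - of_int (n + 1)) *s mode u n v"
    by (simp add: algebra_simps)
  then show ?thesis
    by (simp add: weight_space_iff algebra_simps)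
qed

text \<open>
  Weights are required to be half-integral because components along the weight decomposition are
  indexed by half-integers.
\<close>

definition bihomogeneous :: "int \<Rightarrow> real \<Rightarrow> 'v \<Rightarrow> bool"
  where "bihomogeneous p a u \<longleftrightarrow> a \<in> half_integers \<and> u \<in> deg p \<and> u \<in> weight_space \<omega> a"

lemma bihomogeneous_deg: "bihomogeneous p a u \<Longrightarrow> u \<in> deg p"
  and bihomogeneous_weight: "bihomogeneous p a u \<Longrightarrow> u \<in> weight_space \<omega> a"
  and bihomogeneous_half: "bihomogeneous p a u \<Longrightarrow> a \<in> half_integers"
  by (simp_all add: bihomogeneous_def)

lemma bihomogeneous_vac: "bihomogeneous 0 0 vac"
  using vac_deg half_integers_of_int [of 0] creation(1) [of 1 \<omega>]
  by (simp add: bihomogeneous_def weight_space_iff)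

lemma bihomogeneous_mode:
  assumes "bihomogeneous p a u" "bihomogeneous q b v"
  shows "bihomogeneous (p + q - 2 * n - 2) (a + b - of_int n - 1) (mode u n v)"
proof -
  have "a + b + of_int (- n - 1) \<in> half_integers"
    using assms by (intro half_integers_shift half_integers_add) (simp_all add: bihomogeneous_def)
  moreover have "mode u n v \<in> deg (p + q - 2 * n - 2)"
    using mode_deg [of u p v q n] assms by (simp add: bihomogeneous_def algebra_simps)
  ultimately show ?thesis
    using assms mode_weight [of u p a v b n] by (simp add: bihomogeneous_def algebra_simps)
qed

lemma bihomogeneous_translation:
  assumes "bihomogeneous p a u"
  shows "bihomogeneous (p + 2) (a + 1) (mode u (-2) vac)"
  using bihomogeneous_mode [OF assms bihomogeneous_vac, of "-2"] by (simp add: algebra_simps)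

lemma weight_space_d:
  assumes "u \<in> weight_space \<omega> a"
  shows "d u \<in> weight_space \<omega> a"
proof -
  have "mode (d \<omega>) 1 u = d (mode \<omega> 1 u) - mode \<omega> 1 (d u)"
    using mode_d [OF conformal_deg, of 1 u] by simp
  then have "mode \<omega> 1 (d u) = d (mode \<omega> 1 u)" by (simp add: d_conformal)
  then show ?thesis using assms by (simp add: weight_space_iff)
qed

lemma bihomogeneous_d: "bihomogeneous p a u \<Longrightarrow> bihomogeneous (p + 1) a (d u)"
  by (simp add: bihomogeneous_def weight_space_d d_deg)

text \<open>
  Since $L(0)$ preserves degrees, projecting the weight components of a vector of degree \<open>q\<close> to degree
  \<open>q\<close> keeps their weights; the projections still add up to that vector.
\<close>

lemma deg_subset_span:
  assumes u: "u \<in> deg q"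
  shows "u \<in> span {x. \<exists>a. bihomogeneous q a x}"
proof -
  let ?C = "component half_integers (weight_space \<omega>)" and ?D = "component UNIV deg"
  have L0: "mode \<omega> 1 x \<in> deg p" if "x \<in> deg p" for x p
    using mode_deg [OF conformal_deg that, of 1] by simp
  have comm: "?D (mode \<omega> 1 x) = (\<lambda>i. mode \<omega> 1 (?D x i))" for x
    by (rule component_commutes [OF deg_direct_sum mode_linear_right]) (rule L0)
  have "bihomogeneous q r (?D (?C u r) q)" if "r \<in> half_integers" for r
  proof -
    have "mode \<omega> 1 (?D (?C u r) q) = ?D (mode \<omega> 1 (?C u r)) q"
      by (simp add: comm)
    also have "mode \<omega> 1 (?C u r) = of_real r *s ?C u r"
      using component_mem [OF weight_direct_sum that, of u] by (simp only: weight_space_iff)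
    also have "?D (of_real r *s ?C u r) q = of_real r *s ?D (?C u r) q"
      by (rule endomorphism_scale [OF component_endomorphism [OF deg_direct_sum]])
    finally show ?thesis
      using that component_mem [OF deg_direct_sum, of q "?C u r"]
      by (simp add: bihomogeneous_def weight_space_iff)
  qed
  moreover have "?D (?C u r) q = 0" if "r \<notin> half_integers" for r
    using that endomorphism_zero [OF component_endomorphism [OF deg_direct_sum]]
    by (simp add: component_outside [OF weight_direct_sum])
  ultimately have mem: "?D (?C u r) q \<in> span {x. \<exists>a. bihomogeneous q a x}" for r
    by (cases "r \<in> half_integers") (auto intro: span_base simp: span_zero)
  have "u = ?D u q"
    by (simp add: component_summand [OF deg_direct_sum _ u])
  also have "\<dots> = ?D (Sum_any (?C u)) q"
    by (simp only: Sum_any_component [OF weight_direct_sum])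
  also have "\<dots> = Sum_any (\<lambda>r. ?D (?C u r) q)"
    by (rule endomorphism_Sum_any [OF component_endomorphism [OF deg_direct_sum]
          finite_component [OF weight_direct_sum]])
  also have "\<dots> \<in> span {x. \<exists>a. bihomogeneous q a x}"
    by (rule subspace_Sum_any) (simp_all add: mem)
  finally show ?thesis .
qed

lemma span_deg_eq:
  "span (\<Union>q\<in>{..p}. deg q) = span {u. \<exists>q a. q \<le> p \<and> bihomogeneous q a u}"
proof (rule antisym)
  have "deg q \<subseteq> span {u. \<exists>q a. q \<le> p \<and> bihomogeneous q a u}" if "q \<le> p" for q
  proof
    fix u assume "u \<in> deg q"
    then have "u \<in> span {x. \<exists>a. bihomogeneous q a x}" by (rule deg_subset_span)
    also have "\<dots> \<subseteq> span {u. \<exists>q a. q \<le> p \<and> bihomogeneous q a u}"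
      by (rule span_mono) (use that in auto)
    finally show "u \<in> span {u. \<exists>q a. q \<le> p \<and> bihomogeneous q a u}" .
  qed
  then show "span (\<Union>q\<in>{..p}. deg q) \<subseteq> span {u. \<exists>q a. q \<le> p \<and> bihomogeneous q a u}"
    by (intro span_minimal) auto
  show "span {u. \<exists>q a. q \<le> p \<and> bihomogeneous q a u} \<subseteq> span (\<Union>q\<in>{..p}. deg q)"
    by (rule span_mono) (auto simp: bihomogeneous_def)
qed

lemma span_bihomogeneous: "span {u. \<exists>p a. bihomogeneous p a u} = UNIV"
proof -
  have "x \<in> span {u. \<exists>p a. bihomogeneous p a u}" for x
  proof -
    have "component UNIV deg x q \<in> span {u. \<exists>p a. bihomogeneous p a u}" for q
    proof -
      have "component UNIV deg x q \<in> span {x. \<exists>a. bihomogeneous q a x}"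
        by (rule deg_subset_span [OF component_mem [OF deg_direct_sum UNIV_I]])
      also have "\<dots> \<subseteq> span {u. \<exists>p a. bihomogeneous p a u}"
        by (rule span_mono) auto
      finally show ?thesis .
    qed
    then have "Sum_any (component UNIV deg x) \<in> span {u. \<exists>p a. bihomogeneous p a u}"
      by (intro subspace_Sum_any) simp_all
    then show ?thesis by (simp only: Sum_any_component [OF deg_direct_sum])
  qed
  then show ?thesis by blast
qed

section \<open>The associative product on the Zhu algebra\<close>

lemma zhu_product_residues:
  "zhu_product k u v =
    Sum_any (\<lambda>r. residue (of_real r) k (component half_integers (weight_space \<omega>) u r) v)"
  by (simp add: zhu_product_def residue_def)

lemma zhu_product_weight:
  assumes "u \<in> weight_space \<omega> a" "a \<in> half_integers"
  shows "zhu_product k u v = residue (of_real a) k u v"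
proof -
  have "zhu_product k u v = Sum_any (\<lambda>r. residue (of_real r) k (if r = a then u else 0) v)"
    unfolding zhu_product_residues component_summand [OF weight_direct_sum assms(2,1)] ..
  also have "\<dots> = Sum_any (\<lambda>r. if r = a then residue (of_real r) k u v else 0)"
    by (rule Sum_any.cong) simp
  finally show ?thesis by simp
qed

lemma zhu_product_bihomogeneous:
  "bihomogeneous p a u \<Longrightarrow> zhu_product k u v = residue (of_real a) k u v"
  by (rule zhu_product_weight) (simp_all add: bihomogeneous_def)

lemma finite_weight_residues:
  "finite {r. residue (c r) k (component half_integers (weight_space \<omega>) u r) v \<noteq> 0}"
  by (rule finite_subset [OF _ finite_component [OF weight_direct_sum, of u]]) auto

lemma zhu_product_linear_left: "endomorphism scale (\<lambda>u. zhu_product k u v)"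
  unfolding zhu_product_residues
  by (intro endomorphism_Sum_any_family endomorphism_compose [OF residue_linear_left]
      component_endomorphism [OF weight_direct_sum] finite_weight_residues)

lemma zhu_product_linear_right: "endomorphism scale (zhu_product k u)"
proof -
  have "endomorphism scale (\<lambda>v. zhu_product k u v)"
    unfolding zhu_product_residues
    by (intro endomorphism_Sum_any_family residue_linear_right finite_weight_residues)
  then show ?thesis by simp
qed

lemmas zhu_product_left [simp] =
  endomorphism_add [OF zhu_product_linear_left] endomorphism_scale [OF zhu_product_linear_left]
  endomorphism_zero [OF zhu_product_linear_left] endomorphism_diff [OF zhu_product_linear_left]

lemmas zhu_product_right [simp] =
  endomorphism_add [OF zhu_product_linear_right] endomorphism_scale [OF zhu_product_linear_right]
  endomorphism_zero [OF zhu_product_linear_right] endomorphism_diff [OF zhu_product_linear_right]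

text \<open>
  Identities modulo a subspace between bilinear expressions need only be checked on bihomogeneous
  vectors, where degrees and weights supply the signs and the exponents.
\<close>

lemma bilinear_bihomogeneous_induct:
  assumes l: "\<And>y. endomorphism scale (\<lambda>x. h x y)" and r: "\<And>x. endomorphism scale (h x)"
    and S: "subspace S"
    and B: "\<And>p a u q b v. bihomogeneous p a u \<Longrightarrow> bihomogeneous q b v \<Longrightarrow> h u v \<in> S"
  shows "h x y \<in> S"
  by (rule bilinear_image_span [OF l r S, of "{u. \<exists>p a. bihomogeneous p a u}" "{u. \<exists>p a. bihomogeneous p a u}"])
    (auto simp: span_bihomogeneous intro: B)

lemma subspace_zhu_O: "subspace zhu_O"
  by (simp add: zhu_O_def)

lemmas zhu_O_closed =
  subspace_add [OF subspace_zhu_O] subspace_diff [OF subspace_zhu_O]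
  subspace_scale [OF subspace_zhu_O] subspace_0 [OF subspace_zhu_O] subspace_neg [OF subspace_zhu_O]

lemma zhu_circ_in_zhu_O: "zhu_circ u v \<in> zhu_O"
  unfolding zhu_O_def by (rule span_base) blast

lemma zhu_O_bihomogeneous:
  "zhu_O = span {zhu_circ u v | u v p a q b. bihomogeneous p a u \<and> bihomogeneous q b v}" (is "_ = span ?B")
proof (rule antisym)
  have "zhu_circ u v \<in> span ?B" for u v
  proof (rule bilinear_bihomogeneous_induct [of zhu_circ])
    show "zhu_circ u v \<in> span ?B" if "bihomogeneous p a u" "bihomogeneous q b v" for p a u q b v
      by (rule span_base) (use that in blast)
  qed (simp_all add: zhu_circ_def zhu_product_linear_left zhu_product_linear_right)
  then show "zhu_O \<subseteq> span ?B"
    unfolding zhu_O_def by (intro span_minimal) auto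
  show "span ?B \<subseteq> zhu_O"
    unfolding zhu_O_def by (rule span_mono) blast
qed

text \<open>
  Zhu's lemma. The case \<open>k = 0\<close> is the definition of \<open>zhu_O\<close>. Applying the claim for \<open>k\<close> to $L(-1)u$, of weight
  $a + 1$, and integrating by parts gives the claim for \<open>k + 1\<close> with exponent $a + 1$, and Pascal's rule
  brings the exponent back to \<open>a\<close>.
\<close>

lemma residue_in_zhu_O:
  assumes "bihomogeneous p a u"
  shows "residue (of_real a) (- 2 - int k) u v \<in> zhu_O"
  using assms
proof (induction k arbitrary: p a u)
  case 0
  then show ?case
    using zhu_circ_in_zhu_O [of u v] by (simp add: zhu_circ_def zhu_product_bihomogeneous)
next
  case (Suc k)
  let ?R = "\<lambda>b. residue b (- 2 - int (Suc k)) u v"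
  have low: "residue (of_real a) (- 2 - int k) u v \<in> zhu_O" by (rule Suc.IH [OF Suc.prems])
  have "residue (of_real (a + 1)) (- 2 - int k) (mode u (-2) vac) v \<in> zhu_O"
    by (rule Suc.IH [OF bihomogeneous_translation [OF Suc.prems]])
  from subspace_add [OF subspace_zhu_O this subspace_scale [OF subspace_zhu_O low, of "of_real a + 1"]]
  have "(2 + of_nat k) *s ?R (of_real a + 1) \<in> zhu_O"
    using residue_translation [OF bihomogeneous_deg [OF Suc.prems], of "of_real a" "- 2 - int k" v]
    by (simp add: algebra_simps)
  then have "inverse (2 + of_nat k) *s (2 + of_nat k) *s ?R (of_real a + 1) \<in> zhu_O"
    by (rule subspace_scale [OF subspace_zhu_O])
  moreover have "(2 + of_nat k :: complex) \<noteq> 0"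
    by (metis of_nat_Suc of_nat_numeral of_nat_add of_nat_eq_0_iff add_is_0 zero_neq_numeral)
  ultimately have high: "?R (of_real a + 1) \<in> zhu_O" by simp
  have "?R (of_real a + 1) = ?R (of_real a) + residue (of_real a) (- 2 - int k) u v"
    using residue_pascal [of "of_real a" "- 2 - int (Suc k)" u v] by simp
  then have "?R (of_real a) = ?R (of_real a + 1) - residue (of_real a) (- 2 - int k) u v" by simp
  then show ?case by (simp only: zhu_O_closed(2) high low)
qed

lemma residue_in_zhu_O_le:
  assumes "bihomogeneous p a u" "k \<le> - 2"
  shows "residue (of_real a) k u v \<in> zhu_O"
  using residue_in_zhu_O [OF assms(1), of "nat (- 2 - k)" v] assms(2) by simp

lemma finite_borcherds_terms:
  "finite {i::nat. c i *s (residue a (l - int i) u (residue b (k + int i) v w)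
     - s *s residue b (k' - int i) v (residue a' (int i) u w)) \<noteq> 0}"
proof -
  have "finite ({i::nat. residue b (int i + k) v w \<noteq> 0} \<union> {i::nat. residue a' (int i + 0) u w \<noteq> 0})"
    by (intro finite_UnI finite_residues)
  then show ?thesis by (rule finite_subset [rotated]) (auto simp: add.commute)
qed

text \<open>
  The vector $u_{l+i}v$ has weight $a + b - l - i - 1$, so choosing the second exponent as $b - l - 1$ makes
  the right-hand side of \<open>borcherds_residue\<close> a Zhu product with $\mathrm{Res}_x\,(1+x)^a x^l\,Y(u,x)v$.
\<close>

lemma zhu_product_of_residue:
  assumes u: "bihomogeneous p a u" and v: "bihomogeneous q b v"
  shows "zhu_product k (residue (of_real a) l u v) w =
    Sum_any (\<lambda>i::nat. ((-1) ^ i * (of_int l gchoose i)) *s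
      (residue (of_real a) (l - int i) u (residue (of_real b - of_int l - 1) (k + int i) v w)
        - ((-1) powi l * (-1) powi (p * q)) *s
          residue (of_real b - of_int l - 1) (k + l - int i) v (residue (of_real a) (int i) u w)))"
proof -
  have "zhu_product k (residue (of_real a) l u v) w =
    Sum_any (\<lambda>i. (of_real a gchoose i) *s zhu_product k (mode u (int i + l) v) w)"
    unfolding residue_def
    by (subst endomorphism_Sum_any [OF zhu_product_linear_left finite_residue_terms]) simp
  also have "\<dots> = Sum_any (\<lambda>i. (of_real a gchoose i) *s
    residue (of_real a + (of_real b - of_int l - 1) - of_nat i) k (mode u (l + int i) v) w)"
    by (intro Sum_any.cong)
      (simp add: zhu_product_bihomogeneous [OF bihomogeneous_mode [OF u v]] algebra_simps)
  finally show ?thesis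
    unfolding borcherds_residue [OF bihomogeneous_deg [OF u] bihomogeneous_deg [OF v], symmetric] .
qed

text \<open>
  The case $l = -1$ of \<open>zhu_product_of_residue\<close>. The \<open>u\<close>-residue in the term $i = 0$ is the subtracted
  product; all other parts are residues of \<open>u\<close> or of \<open>v\<close>
  at their own weights with second index at most $-2$. For $k = -1$ this is associativity, and for
  $k = -2$ it shows that left multiplication preserves \<open>zhu_O\<close>.
\<close>

lemma zhu_product_star:
  assumes k: "k < 0"
  shows "zhu_product k (zhu_star u v) w - zhu_star u (zhu_product k v w) \<in> zhu_O"
proof (rule bilinear_bihomogeneous_induct
    [of "\<lambda>u v. zhu_product k (zhu_star u v) w - zhu_star u (zhu_product k v w)"])
  fix p a u q b v
  assume u: "bihomogeneous p a u" and v: "bihomogeneous q b v"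
  let ?f = "\<lambda>i::nat. ((-1) ^ i * (of_int (-1) gchoose i)) *s
    (residue (of_real a) (-1 - int i) u (residue (of_real b) (k + int i) v w)
      - ((-1) powi (-1) * (-1) powi (p * q)) *s
        residue (of_real b) (k + -1 - int i) v (residue (of_real a) (int i) u w))"
  have "zhu_product k (zhu_star u v) w = Sum_any ?f"
    using zhu_product_of_residue [OF u v, of k "-1" w]
    by (simp add: zhu_star_def zhu_product_bihomogeneous [OF u])
  also have "\<dots> = ?f 0 + Sum_any (\<lambda>i. ?f (Suc i))"
    by (rule Sum_any_Suc_shift) (rule finite_borcherds_terms)
  finally have "zhu_product k (zhu_star u v) w - zhu_star u (zhu_product k v w) =
    - (((-1) powi (-1) * (-1) powi (p * q)) *s
        residue (of_real b) (k - 1) v (residue (of_real a) 0 u w)) + Sum_any (\<lambda>i. ?f (Suc i))"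
    by (simp add: zhu_star_def zhu_product_bihomogeneous [OF u] zhu_product_bihomogeneous [OF v])
  also have "\<dots> \<in> zhu_O"
    by (intro zhu_O_closed subspace_Sum_any [OF subspace_zhu_O] residue_in_zhu_O_le [OF u]
        residue_in_zhu_O_le [OF v]) (use k in auto)
  finally show "zhu_product k (zhu_star u v) w - zhu_star u (zhu_product k v w) \<in> zhu_O" .
qed (auto simp: zhu_star_def intro!: subspace_zhu_O endomorphismI simp: algebra_simps)

text \<open>
  The case $l = -2$ of \<open>zhu_product_of_residue\<close>. Here the exponent for \<open>v\<close> is $b + 1$ instead of the weight \<open>b\<close>, but the index is at
  most $-3$, so Pascal's rule leaves two residues at the weight \<open>b\<close> with indices at most $-2$.
\<close>

lemma zhu_star_zhu_O_left:
  assumes "x \<in> zhu_O"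
  shows "zhu_star x w \<in> zhu_O"
proof -
  have "zhu_star (zhu_circ u v) w \<in> zhu_O"
    if u: "bihomogeneous p a u" and v: "bihomogeneous q b v" for p a u q b v
  proof -
    have shift: "residue (of_real b + 1) k v x \<in> zhu_O" if "k \<le> - 3" for k x
      unfolding residue_pascal
      by (intro zhu_O_closed residue_in_zhu_O_le [OF v]) (use that in auto)
    have "zhu_star (zhu_circ u v) w = Sum_any (\<lambda>i::nat. ((-1) ^ i * (of_int (-2) gchoose i)) *s
      (residue (of_real a) (-2 - int i) u (residue (of_real b + 1) (-1 + int i) v w)
        - ((-1) powi (-2) * (-1) powi (p * q)) *s
          residue (of_real b + 1) (-1 + -2 - int i) v (residue (of_real a) (int i) u w)))"
      using zhu_product_of_residue [OF u v, of "-1" "-2" w]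
      by (simp add: zhu_star_def zhu_circ_def zhu_product_bihomogeneous [OF u] add.commute)
    also have "\<dots> \<in> zhu_O"
      by (intro zhu_O_closed subspace_Sum_any [OF subspace_zhu_O] residue_in_zhu_O_le [OF u] shift) auto
    finally show ?thesis .
  qed
  then show ?thesis
    using endomorphism_image_span [of "\<lambda>x. zhu_star x w" zhu_O
        "{zhu_circ u v | u v p a q b. bihomogeneous p a u \<and> bihomogeneous q b v}" x]
      assms subspace_zhu_O zhu_product_linear_left [of "-1" w]
    unfolding zhu_O_bihomogeneous [symmetric] zhu_star_def by blast
qed

lemma zhu_star_zhu_O_right:
  assumes "x \<in> zhu_O"
  shows "zhu_star u x \<in> zhu_O"
proof (rule endomorphism_image_span [where h = "zhu_star u"])
  show "endomorphism scale (zhu_star u)"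
    unfolding zhu_star_def by (rule zhu_product_linear_right)
  show "x \<in> span {zhu_circ v w | v w. True}"
    using assms by (simp add: zhu_O_def)
  fix y assume "y \<in> {zhu_circ v w | v w. True}"
  then obtain v w where y: "y = zhu_circ v w" by blast
  have "zhu_circ (zhu_star u v) w - zhu_star u (zhu_circ v w) \<in> zhu_O"
    unfolding zhu_circ_def by (rule zhu_product_star) simp
  then have "zhu_circ (zhu_star u v) w
      - (zhu_circ (zhu_star u v) w - zhu_star u (zhu_circ v w)) \<in> zhu_O"
    by (rule zhu_O_closed(2) [OF zhu_circ_in_zhu_O])
  then show "zhu_star u y \<in> zhu_O" by (simp only: y diff_diff_eq2 add_diff_cancel_left')
qed (rule subspace_zhu_O)

lemma zhu_star_assoc: "zhu_star (zhu_star u v) w - zhu_star u (zhu_star v w) \<in> zhu_O"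
  using zhu_product_star [of "-1" u v w] by (simp add: zhu_star_def)

end

section \<open>The commutator on the Zhu algebra\<close>

text \<open>
  The coefficient of $x^n$ in $\left(1 - \frac x{1+x}\right)^b (1+x)^c = (1+x)^{c-b}$. Negating the upper
  indices turns it into Vandermonde's identity.
\<close>

lemma gbinomial_alternating_convolution:
  fixes b c :: "'a::field_char_0"
  shows "(\<Sum>j\<le>n. (-1) ^ j * (b gchoose j) * ((c - of_nat j) gchoose (n - j))) = ((c - b) gchoose n)"
proof -
  have "(-1) ^ j * (b gchoose j) * ((c - of_nat j) gchoose (n - j)) =
      (-1) ^ n * ((b gchoose j) * ((of_nat n - c - 1) gchoose (n - j)))" if "j \<in> {..n}" for j
  proof -
    from that have "j \<le> n" by simp
    have "((c - of_nat j) gchoose (n - j)) =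
        (-1) ^ (n - j) * ((of_nat (n - j) - (c - of_nat j) - 1) gchoose (n - j))"
      by (rule gbinomial_negated_upper)
    also have "of_nat (n - j) - (c - of_nat j) - 1 = of_nat n - c - 1"
      using \<open>j \<le> n\<close> by (simp add: of_nat_diff)
    finally have "(-1) ^ j * (b gchoose j) * ((c - of_nat j) gchoose (n - j)) =
      ((-1) ^ j * (-1) ^ (n - j)) * ((b gchoose j) * ((of_nat n - c - 1) gchoose (n - j)))"
      by (simp only: ac_simps)
    also have "(-1) ^ j * (-1) ^ (n - j) = ((-1) ^ n :: 'a)"
      using \<open>j \<le> n\<close> by (simp flip: power_add)
    finally show ?thesis .
  qed
  then have "(\<Sum>j\<le>n. (-1) ^ j * (b gchoose j) * ((c - of_nat j) gchoose (n - j))) =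
    (-1) ^ n * (\<Sum>j\<le>n. (b gchoose j) * ((of_nat n - c - 1) gchoose (n - j)))"
    unfolding sum_distrib_left by (rule sum.cong [OF refl])
  also have "\<dots> = (-1) ^ n * ((of_nat n - (c - b) - 1) gchoose n)"
    by (simp add: atMost_atLeast0 gbinomial_Vandermonde algebra_simps)
  also have "\<dots> = ((c - b) gchoose n)"
    by (rule gbinomial_negated_upper [symmetric])
  finally show ?thesis .
qed

lemma (in vector_space) subspace_scale_cancel:
  assumes S: "subspace S" and "c \<noteq> 0" and "scale c x \<in> S"
  shows "x \<in> S"
  using subspace_scale [OF S assms(3), of "inverse c"] assms(2) by simp

lemma power_int_minus_one_square: "((-1) powi n * (-1) powi n :: 'a::field) = 1"
  by (simp add: power_int_mult_distrib [symmetric])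

context dg_vertex_operator_algebra
begin

text \<open>
  This element is $w \circ \mathbf 1$: modulo \<open>zhu_O\<close>, $L(-1)$ acts as $-L(0)$.
\<close>

lemma translation_mod_zhu_O:
  assumes w: "bihomogeneous p h w"
  shows "mode w (-2) vac + of_real h *s w \<in> zhu_O"
proof -
  have "mode w (int n + (-2)) vac = 0" if "n \<notin> {0, 1}" for n
    using that by (intro creation) auto
  then have "residue (of_real h) (-2) w vac =
    (\<Sum>n\<in>{0, 1}. (of_real h gchoose n) *s mode w (int n + (-2)) vac)"
    unfolding residue_def by (intro Sum_any.expand_superset) fastforce+
  then show ?thesis
    using residue_in_zhu_O_le [OF w, of "-2" vac] by (simp add: creation)
qed

text \<open>
  Since $w_{-1-i}\mathbf 1 = \frac1{i!}L(-1)^i w$ and each factor $L(-1)$ raises the weight by one, the previous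
  congruence yields the product of $-h, -h-1, \dots, -h-i+1$ divided by $i!$. In generating
  form, $e^{xL(-1)}w \equiv (1+x)^{-h}w$.
\<close>

lemma creation_modes_mod_zhu_O:
  assumes "bihomogeneous p h w"
  shows "mode w (-1 - int i) vac - ((- of_real h) gchoose i) *s w \<in> zhu_O"
  using assms
proof (induction i arbitrary: p h w)
  case 0
  then show ?case by (simp add: creation zhu_O_closed)
next
  case (Suc i)
  let ?w' = "mode w (-2) vac" and ?X = "mode w (-1 - int (Suc i)) vac"
  define c :: complex where "c = (- of_real (h + 1)) gchoose i"
  have A: "mode ?w' (-1 - int i) vac - c *s ?w' \<in> zhu_O"
    unfolding c_def by (rule Suc.IH [OF bihomogeneous_translation [OF Suc.prems]])
  have B: "mode ?w' (-1 - int i) vac = of_nat (Suc i) *s ?X"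
    unfolding mode_translation [OF bihomogeneous_deg [OF Suc.prems]]
    by (simp add: algebra_simps)
  have "of_nat (Suc i) *s ?X - c *s ?w' + c *s (?w' + of_real h *s w) \<in> zhu_O"
    unfolding B [symmetric]
    by (rule zhu_O_closed(1) [OF A zhu_O_closed(3) [OF translation_mod_zhu_O [OF Suc.prems]]])
  moreover have "of_nat (Suc i) * ((- of_real h) gchoose Suc i) = - of_real h * c"
    using gbinomial_absorption [of i "- of_real h"] by (simp add: c_def)
  ultimately have "of_nat (Suc i) *s (?X - ((- of_real h) gchoose Suc i) *s w) \<in> zhu_O"
    by (simp add: scale_right_diff_distrib scale_right_distrib mult.commute del: of_nat_Suc)
  then show ?case
    by (rule subspace_scale_cancel [OF subspace_zhu_O, rotated]) (simp del: of_nat_Suc)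
qed

text \<open>
  Skew symmetry $Y(v,x)u = \pm e^{xL(-1)}Y(u,-x)v$, with the exponential replaced by its value modulo
  \<open>zhu_O\<close>. It is derived from the Jacobi identity applied to the vacuum with $m = -1$ and $n = 0$, where the
  creation property leaves only $v_l u$ on the left-hand side.
\<close>

lemma skew_symmetry_mod_zhu_O:
  assumes u: "bihomogeneous p a u" and v: "bihomogeneous q b v"
  shows "mode v l u + ((-1) powi l * (-1) powi (p * q)) *s
    residue (of_real (a + b) - of_int l - 2) l u v \<in> zhu_O"
proof -
  define e :: complex where "e = (-1) powi l * (-1) powi (p * q)"
  have ee: "e * e = 1"
    using power_int_minus_one_square [of l] power_int_minus_one_square [of "p * q"]
    by (simp add: e_def ac_simps)
  let ?g = "\<lambda>i::nat. (of_int (-1) gchoose i) *s mode (mode u (l + int i) v) (-1 + 0 - int i) vac"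
  let ?r = "\<lambda>i::nat. ((of_real (a + b) - of_int l - 2) gchoose i) *s mode u (int i + l) v"
  have fin: "finite {i. ?g i \<noteq> 0}" "finite {i. ?r i \<noteq> 0}"
    by (rule finite_subset [OF _ finite_modes [of u l v]], force simp: add.commute)+
  have "- (e *s mode v l u) = Sum_any (\<lambda>i::nat. ((-1) ^ i * (of_int l gchoose i)) *s
    (mode u (-1 + l - int i) (mode v (0 + int i) vac)
      - e *s mode v (0 + l - int i) (mode u (-1 + int i) vac)))"
    by (subst Sum_any_only_zero) (simp_all add: creation)
  also have "\<dots> = Sum_any ?g"
    unfolding e_def by (rule jacobi [OF bihomogeneous_deg [OF u] bihomogeneous_deg [OF v]])
  finally have "- (e *s mode v l u) - residue (of_real (a + b) - of_int l - 2) l u v =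
    Sum_any (\<lambda>i. ?g i + (-1) *s ?r i)"
    unfolding residue_def
    by (subst Sum_any.distrib [OF fin(1) finite_support_scale [OF fin(2)]],
        subst scale_Sum_any [OF fin(2), symmetric]) simp
  also have "\<dots> \<in> zhu_O"
  proof (rule subspace_Sum_any [OF subspace_zhu_O])
    fix i
    \<comment> \<open>The weight of $u_{l+i}v$. The coefficients match because
      $(-1)^i \binom{-h}{i} = \binom{h+i-1}{i}$ and $h + i - 1$ is independent of $i$.\<close>
    let ?h = "a + b - of_int (l + int i) - 1"
    have "mode (mode u (l + int i) v) (-1 - int i) vac -
        ((- of_real ?h) gchoose i) *s mode u (l + int i) v \<in> zhu_O"
      by (rule creation_modes_mod_zhu_O [OF bihomogeneous_mode [OF u v]])
    then have "(of_int (-1) gchoose i) *s (mode (mode u (l + int i) v) (-1 - int i) vac -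
        ((- of_real ?h) gchoose i) *s mode u (l + int i) v) \<in> zhu_O"
      by (rule zhu_O_closed)
    moreover have "(of_int (-1) gchoose i) * ((- of_real ?h) gchoose i) =
      ((of_real (a + b) - of_int l - 2) gchoose i :: complex)"
    proof -
      have "(of_int (-1) gchoose i) = ((-1) ^ i :: complex)"
        using gbinomial_minus [of "1::complex" i] binomial_gbinomial [of i i, where 'a = complex]
        by simp
      moreover have "((- of_real ?h) gchoose i) =
          (-1) ^ i * ((of_real (a + b) - of_int l - 2) gchoose i :: complex)"
        using gbinomial_minus [of "of_real ?h :: complex" i] by (simp add: algebra_simps)
      ultimately show ?thesis by simp
    qed
    ultimately show "?g i + (-1) *s ?r i \<in> zhu_O"
      by (simp add: scale_right_diff_distrib add.commute)
  qed
  finally have "(- e) *s (- (e *s mode v l u) - residue (of_real (a + b) - of_int l - 2) l u v) \<in> zhu_O"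
    by (rule zhu_O_closed)
  then show ?thesis
    by (simp add: scale_right_diff_distrib ee flip: e_def)
qed

text \<open>
  Inserting skew symmetry into $v \ast u = \sum_j \binom bj v_{j-1}u$ produces
  $\sum_j \binom bj (-1)^j \left(\frac x{1+x}\right)^j = (1+x)^{-b}$ as a factor of
  $(1+x)^{a+b-1}x^{-1}$ under the residue, which leaves the exponent $a - 1$.
\<close>

lemma zhu_star_swap:
  assumes u: "bihomogeneous p a u" and v: "bihomogeneous q b v"
  shows "zhu_star v u - (-1) powi (p * q) *s residue (of_real a - 1) (-1) u v \<in> zhu_O"
proof -
  define s :: complex where "s = (-1) powi (p * q)"
  define c :: complex where "c = of_real (a + b) - 1"
  let ?X = "\<lambda>j::nat. mode v (int j + (-1)) u"
  let ?R = "\<lambda>j::nat. residue (c - of_nat j) (int j + (-1)) u v"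
  have fin: "finite {j. (b' j) *s ?X j \<noteq> 0}" "finite {j. (b' j) *s ?R j \<noteq> 0}" for b'
    by (intro finite_support_scale finite_modes finite_residues)+
  have term_mod: "(of_real b gchoose j) *s ?X j + (- s * ((-1) ^ j * (of_real b gchoose j))) *s ?R j \<in> zhu_O" for j
  proof -
    have "(-1) powi (int j + (-1)) = (- ((-1) ^ j) :: complex)"
      by (simp add: power_int_diff)
    moreover have "of_real (a + b) - of_int (int j + (-1)) - 2 = c - of_nat j"
      by (simp add: c_def)
    ultimately have "?X j + (- ((-1) ^ j) * s) *s ?R j \<in> zhu_O"
      using skew_symmetry_mod_zhu_O [OF u v, of "int j + (-1)"] by (simp only: s_def)
    then have "(of_real b gchoose j) *s (?X j + (- ((-1) ^ j) * s) *s ?R j) \<in> zhu_O"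
      by (rule zhu_O_closed)
    then show ?thesis by (simp add: scale_right_diff_distrib ac_simps)
  qed
  have "Sum_any (\<lambda>j. ((-1) ^ j * (of_real b gchoose j)) *s ?R j) =
    Sum_any (\<lambda>j. Sum_any (\<lambda>n. ((-1) ^ j * (of_real b gchoose j) * ((c - of_nat j) gchoose n)) *s
      mode u (int (j + n) + (-1)) v))"
    unfolding residue_def scale_Sum_any [OF finite_residue_terms]
    by (simp add: ac_simps add_diff_eq)
  also have "\<dots> = Sum_any (\<lambda>n. (\<Sum>j\<le>n. (-1) ^ j * (of_real b gchoose j) * ((c - of_nat j) gchoose (n - j))) *s
      mode u (int n + (-1)) v)"
    by (rule Sum_any_convolution) (rule finite_modes)
  also have "\<dots> = residue (of_real a - 1) (-1) u v"
    unfolding gbinomial_alternating_convolution residue_def by (simp add: c_def)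
  finally have R: "Sum_any (\<lambda>j. ((-1) ^ j * (of_real b gchoose j)) *s ?R j) = residue (of_real a - 1) (-1) u v" .
  have sR: "Sum_any (\<lambda>j. (- s * ((-1) ^ j * (of_real b gchoose j))) *s ?R j) =
    (- s) *s residue (of_real a - 1) (-1) u v"
    by (simp only: R [symmetric] scale_Sum_any [OF fin(2)] scale_scale)
  have "zhu_star v u - s *s residue (of_real a - 1) (-1) u v =
    Sum_any (\<lambda>j. (of_real b gchoose j) *s ?X j + (- s * ((-1) ^ j * (of_real b gchoose j))) *s ?R j)"
    unfolding Sum_any.distrib [OF fin] sR zhu_star_def zhu_product_bihomogeneous [OF v]
      residue_def [of "of_real b"] by simp
  also have "\<dots> \<in> zhu_O"
    by (rule subspace_Sum_any [OF subspace_zhu_O]) (rule term_mod)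
  finally show ?thesis by (simp only: s_def)
qed

text \<open>
  By Pascal's rule the difference between the exponents \<open>a\<close> and $a - 1$ raises the index from $-1$ to $0$,
  so only modes $u_n$ with $n \ge 0$ remain.
\<close>

lemma zhu_commutator:
  assumes u: "bihomogeneous p a u" and v: "bihomogeneous q b v"
  shows "zhu_star u v - (-1) powi (p * q) *s zhu_star v u - residue (of_real a - 1) 0 u v \<in> zhu_O"
proof -
  define s :: complex where "s = (-1) powi (p * q)"
  have ss: "s * s = 1" by (simp add: s_def power_int_minus_one_square)
  have "zhu_star u v = residue (of_real a - 1) (-1) u v + residue (of_real a - 1) 0 u v"
    using residue_pascal [of "of_real a - 1" "-1" u v]
    by (simp add: zhu_star_def zhu_product_bihomogeneous [OF u])
  moreover have "(- s) *s (zhu_star v u - s *s residue (of_real a - 1) (-1) u v) \<in> zhu_O"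
    unfolding s_def by (intro zhu_O_closed zhu_star_swap [OF u v])
  ultimately show ?thesis
    by (simp add: scale_right_diff_distrib ss flip: s_def)
qed

section \<open>The grading by degree minus twice the weight\<close>

text \<open>
  The projection to the vectors with charge \<open>g\<close>, where the charge is degree minus twice weight: in degree \<open>p\<close> it picks the
  component of weight $(p - g)/2$.
\<close>

definition charge_part :: "int \<Rightarrow> 'v \<Rightarrow> 'v"
  where "charge_part g v = Sum_any (\<lambda>p. component half_integers (weight_space \<omega>)
    (component UNIV deg v p) (of_int (p - g) / 2))"

lemma charge_part_linear: "endomorphism scale (charge_part g)"
proof -
  let ?D = "component UNIV deg" and ?C = "component half_integers (weight_space \<omega>)"
  have lin: "endomorphism scale (\<lambda>v. ?C (?D v p) r)" for p r
    by (rule endomorphism_compose [OF component_endomorphism [OF weight_direct_sum]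
          component_endomorphism [OF deg_direct_sum]])
  have "?C 0 r = 0" for r
    by (rule endomorphism_zero [OF component_endomorphism [OF weight_direct_sum]])
  then have fin: "finite {p. ?C (?D v p) (r p) \<noteq> 0}" for v r
    by (intro finite_subset [OF _ finite_component [OF deg_direct_sum, of v]]) auto
  have "endomorphism scale (\<lambda>v. charge_part g v)"
    unfolding charge_part_def by (rule endomorphism_Sum_any_family [OF lin fin])
  then show ?thesis by simp
qed

lemmas charge_part_simps [simp] =
  endomorphism_add [OF charge_part_linear] endomorphism_scale [OF charge_part_linear]
  endomorphism_zero [OF charge_part_linear] endomorphism_diff [OF charge_part_linear]

lemma charge_part_bihomogeneous:
  assumes v: "bihomogeneous q b v"
  shows "charge_part g v = (if of_int q - 2 * b = of_int g then v else 0)"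
proof -
  let ?C = "component half_integers (weight_space \<omega>)"
  have C0: "?C 0 r = 0" for r
    by (rule endomorphism_zero [OF component_endomorphism [OF weight_direct_sum]])
  have "charge_part g v = Sum_any (\<lambda>p. ?C (if p = q then v else 0) (of_int (p - g) / 2))"
    unfolding charge_part_def component_summand [OF deg_direct_sum UNIV_I bihomogeneous_deg [OF v]] ..
  also have "\<dots> = Sum_any (\<lambda>p. if p = q then ?C v (of_int (p - g) / 2) else 0)"
    by (rule Sum_any.cong) (simp add: C0)
  also have "\<dots> = ?C v (of_int (q - g) / 2)" by simp
  also have "\<dots> = (if of_int (q - g) / 2 = b then v else 0)"
    unfolding component_summand [OF weight_direct_sum bihomogeneous_half [OF v] bihomogeneous_weight [OF v]] ..
  also have "of_int (q - g) / 2 = b \<longleftrightarrow> of_int q - 2 * b = of_int g" by auto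
  finally show ?thesis .
qed

text \<open>
  Passing from $u_n v$ to $u_{n+1}v$ lowers the degree by \<open>2\<close> and the weight by \<open>1\<close>, so all terms of
  $u \circ v$ have the same charge.
\<close>

lemma charge_part_circ:
  assumes u: "bihomogeneous p a u" and v: "bihomogeneous q b v"
  shows "charge_part g (zhu_circ u v) =
    (if of_int (p + q) - 2 * (a + b) = of_int g then zhu_circ u v else 0)"
proof -
  have "charge_part g (mode u (int n + (-2)) v) =
      (if of_int (p + q) - 2 * (a + b) = of_int g then mode u (int n + (-2)) v else 0)" for n
    unfolding charge_part_bihomogeneous [OF bihomogeneous_mode [OF u v]] by (simp add: algebra_simps)
  then show ?thesis
    unfolding zhu_circ_def zhu_product_bihomogeneous [OF u] residue_def
    by (subst endomorphism_Sum_any [OF charge_part_linear finite_residue_terms]) simp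
qed

lemma charge_part_zhu_O:
  assumes "x \<in> zhu_O"
  shows "charge_part g x \<in> zhu_O"
proof (rule endomorphism_image_span [OF charge_part_linear subspace_zhu_O])
  show "x \<in> span {zhu_circ u v | u v p a q b. bihomogeneous p a u \<and> bihomogeneous q b v}"
    using assms by (simp only: zhu_O_bihomogeneous)
  show "charge_part g y \<in> zhu_O"
    if "y \<in> {zhu_circ u v | u v p a q b. bihomogeneous p a u \<and> bihomogeneous q b v}" for y
    using that by (auto simp: charge_part_circ zhu_circ_in_zhu_O zhu_O_closed)
qed

text \<open>
  A vector of charge \<open>g\<close> and degree \<open>q\<close> has weight $(q - g)/2$, which falls below the lower bound for the
  weights when \<open>q\<close> is small.
\<close>

lemma charge_part_eventually_zero:
  "\<exists>P. \<forall>x\<in>span {u. \<exists>q a. q \<le> P \<and> bihomogeneous q a u}. charge_part g x = 0"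
proof -
  obtain N where N: "\<And>r. r \<in> half_integers \<Longrightarrow> r < N \<Longrightarrow> weight_space \<omega> r = {0}"
    using weight_bounded_below by blast
  \<comment> \<open>Chosen so that $q \le P$ forces $(q - g)/2 < N$.\<close>
  define P where "P = g + \<lceil>2 * N\<rceil> - 1"
  have "charge_part g x = 0" if "x \<in> span {u. \<exists>q a. q \<le> P \<and> bihomogeneous q a u}" for x
  proof -
    have "charge_part g x \<in> {0}"
    proof (rule endomorphism_image_span [OF charge_part_linear _ _ that])
      fix u assume "u \<in> {u. \<exists>q a. q \<le> P \<and> bihomogeneous q a u}"
      then obtain q a where q: "q \<le> P" and u: "bihomogeneous q a u" by blast
      have "u = 0" if "of_int q - 2 * a = of_int g"
      proof -
        have "a < N"
          using that q ceiling_correct [of "2 * N"] unfolding P_def by linarith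
        then show ?thesis
          using N [OF bihomogeneous_half [OF u]] bihomogeneous_weight [OF u] by auto
      qed
      then show "charge_part g u \<in> {0}"
        by (simp add: charge_part_bihomogeneous [OF u])
    qed simp
    then show ?thesis by simp
  qed
  then show ?thesis by blast
qed

text \<open>
  The sum may be taken over any larger index set, so that the statement is stable under addition of
  vectors.
\<close>

lemma sum_charge_parts:
  "\<exists>S. finite S \<and> (\<forall>T. finite T \<longrightarrow> S \<subseteq> T \<longrightarrow> v = (\<Sum>g\<in>T. charge_part g v))"
proof -
  have "v \<in> span {u. \<exists>p a. bihomogeneous p a u}" by (simp add: span_bihomogeneous)
  then show ?thesis
  proof (induction rule: span_induct_alt)
    case base
    show ?case by (rule exI [of _ "{}"]) simp
  next
    case (step c x y)
    then obtain q b where x: "bihomogeneous q b x" by blast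
    then have "2 * b \<in> \<int>" by (simp add: bihomogeneous_def half_integers_def)
    then obtain m where "2 * b = of_int m" by (auto elim: Ints_cases)
    then have charge: "charge_part g x = (if q - m = g then x else 0)" for g
      unfolding charge_part_bihomogeneous [OF x] by (simp flip: of_int_diff)
    obtain S where S: "finite S" "\<And>T. finite T \<Longrightarrow> S \<subseteq> T \<Longrightarrow> y = (\<Sum>g\<in>T. charge_part g y)"
      using step by blast
    have "c *s x + y = (\<Sum>g\<in>T. charge_part g (c *s x + y))" if T: "finite T" "insert (q - m) S \<subseteq> T" for T
    proof -
      have "(\<Sum>g\<in>T. charge_part g (c *s x + y)) = c *s (\<Sum>g\<in>T. charge_part g x) + (\<Sum>g\<in>T. charge_part g y)"
        by (simp add: sum.distrib scale_sum_right)
      also have "(\<Sum>g\<in>T. charge_part g x) = x"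
        using T by (simp add: charge)
      also have "(\<Sum>g\<in>T. charge_part g y) = y"
        using T S(2) [of T] by simp
      finally show ?thesis ..
    qed
    then show ?case using S(1) by (intro exI [of _ "insert (q - m) S"] conjI finite.insertI) blast+
  qed
qed

text \<open>
  Each charge part of \<open>v\<close> is congruent modulo \<open>zhu_O\<close> to the charge part of a representative of very low
  degree, and the latter vanishes.
\<close>

lemma zhu_filtration_separated:
  assumes "\<And>p. \<exists>x\<in>span (\<Union>q\<in>{..p}. deg q). v - x \<in> zhu_O"
  shows "v \<in> zhu_O"
proof -
  have part: "charge_part g v \<in> zhu_O" for g
  proof -
    obtain P where P: "\<And>x. x \<in> span (\<Union>q\<in>{..P}. deg q) \<Longrightarrow> charge_part g x = 0"
      using charge_part_eventually_zero [of g] unfolding span_deg_eq by blast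
    obtain x where "x \<in> span (\<Union>q\<in>{..P}. deg q)" "v - x \<in> zhu_O" using assms by blast
    then show ?thesis using charge_part_zhu_O [of "v - x" g] P by simp
  qed
  obtain S where "v = (\<Sum>g\<in>S. charge_part g v)" using sum_charge_parts [of v] by blast
  then show ?thesis using subspace_sum [OF subspace_zhu_O, of S "\<lambda>g. charge_part g v"] part by simp
qed

end

section \<open>The degree filtration\<close>

text \<open>
  A minimum over the integers exists only because the indices of the filtration steps that contain \<open>a\<close>
  are bounded below by \<open>k\<close>; counting from \<open>k\<close> reduces it to a minimum over the naturals.
\<close>

lemma filtration_degree_mem:
  fixes F :: "int \<Rightarrow> 'a set"
  assumes mono: "\<And>i j. i \<le> j \<Longrightarrow> F i \<subseteq> F j"
    and i: "a \<in> F i" and k: "a \<notin> F k"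
  shows "a \<in> F (filtration_degree F a)"
proof -
  have low: "k < j" if "a \<in> F j" for j
    using mono [of j k] k that by (meson not_less subsetD)
  define n where "n = (LEAST n. a \<in> F (k + int n))"
  have "a \<in> F (k + int (nat (i - k)))" using low [OF i] i by simp
  then have n: "a \<in> F (k + int n)" unfolding n_def by (rule LeastI)
  have "filtration_degree F a = k + int n"
    unfolding filtration_degree_def
  proof (rule Least_equality, rule n)
    fix j assume j: "a \<in> F j"
    then have "n \<le> nat (j - k)"
      unfolding n_def using low [OF j] by (intro Least_le) simp
    then show "k + int n \<le> j" using low [OF j] by simp
  qed
  then show ?thesis using n by simp
qed

context dg_vertex_operator_algebra
begin

abbreviation degree_upto :: "int \<Rightarrow> 'v set"
  where "degree_upto p \<equiv> span (\<Union>q\<in>{..p}. deg q)"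

lemma degree_upto_mono: "p \<le> q \<Longrightarrow> degree_upto p \<subseteq> degree_upto q"
  by (intro span_mono UN_mono) auto

lemma bihomogeneous_degree_upto: "bihomogeneous p a u \<Longrightarrow> p \<le> i \<Longrightarrow> u \<in> degree_upto i"
  by (rule span_base) (auto simp: bihomogeneous_def)

lemma degree_upto_exhaustive: "\<exists>p. v \<in> degree_upto p"
proof -
  have "v \<in> span {u. \<exists>p a. bihomogeneous p a u}" by (simp add: span_bihomogeneous)
  then show ?thesis
  proof (induction rule: span_induct_alt)
    case base
    show ?case by (simp add: span_zero)
  next
    case (step c x y)
    then obtain p a q where *: "bihomogeneous p a x" "y \<in> degree_upto q" by blast
    then have "x \<in> degree_upto (max p q)" "y \<in> degree_upto (max p q)"
      using bihomogeneous_degree_upto [of p a x "max p q"] degree_upto_mono [of q "max p q"] by auto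
    then show ?case by (intro exI [of _ "max p q"] span_add span_scale)
  qed
qed

lemma residue_degree_upto:
  assumes u: "bihomogeneous p a u" and v: "bihomogeneous q b v" and "p + q - 2 * k - 2 \<le> i"
  shows "residue c k u v \<in> degree_upto i"
  unfolding residue_def
  by (intro subspace_Sum_any subspace_span span_scale
      bihomogeneous_degree_upto [OF bihomogeneous_mode [OF u v]]) (use assms(3) in simp)

lemma zhu_star_degree:
  assumes "bihomogeneous p a u" "bihomogeneous q b v" "p + q \<le> i"
  shows "zhu_star u v \<in> degree_upto i"
  unfolding zhu_star_def zhu_product_bihomogeneous [OF assms(1)]
  by (rule residue_degree_upto [OF assms(1,2)]) (use assms(3) in simp)

lemma zhu_star_linear_left: "endomorphism scale (\<lambda>u. zhu_star u v)"
  unfolding zhu_star_def by (rule zhu_product_linear_left)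

lemma zhu_star_linear_right: "endomorphism scale (zhu_star u)"
  unfolding zhu_star_def by (rule zhu_product_linear_right)

lemmas zhu_star_left [simp] =
  endomorphism_add [OF zhu_star_linear_left] endomorphism_scale [OF zhu_star_linear_left]
  endomorphism_zero [OF zhu_star_linear_left] endomorphism_diff [OF zhu_star_linear_left]

lemmas zhu_star_right [simp] =
  endomorphism_add [OF zhu_star_linear_right] endomorphism_scale [OF zhu_star_linear_right]
  endomorphism_zero [OF zhu_star_linear_right] endomorphism_diff [OF zhu_star_linear_right]

lemma degree_upto_bilinear:
  assumes "\<And>y. endomorphism scale (\<lambda>x. h x y)" "\<And>x. endomorphism scale (h x)" "subspace S"
    and "\<And>p a u q b v. \<lbrakk>bihomogeneous p a u; p \<le> i; bihomogeneous q b v; q \<le> j\<rbrakk> \<Longrightarrow> h u v \<in> S"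
    and "x \<in> degree_upto i" "y \<in> degree_upto j"
  shows "h x y \<in> S"
  by (rule bilinear_image_span [OF assms(1-3) _ assms(5,6) [unfolded span_deg_eq]]) (auto intro: assms(4))

lemma zhu_star_degree_upto:
  assumes "x \<in> degree_upto i" "y \<in> degree_upto j"
  shows "zhu_star x y \<in> degree_upto (i + j)"
  by (rule degree_upto_bilinear [OF zhu_star_linear_left zhu_star_linear_right subspace_span _ assms])
    (rule zhu_star_degree, auto)

lemma d_degree_upto:
  assumes "x \<in> degree_upto i"
  shows "d x \<in> degree_upto (i + 1)"
proof (rule endomorphism_image_span [OF d_linear subspace_span _ assms])
  fix y assume "y \<in> (\<Union>q\<in>{..i}. deg q)"
  then obtain q where "q + 1 \<le> i + 1" "d y \<in> deg (q + 1)" by (auto dest: d_deg)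
  then show "d y \<in> degree_upto (i + 1)" by (intro span_base) blast
qed

lemma d_zhu_product:
  assumes u: "bihomogeneous p a u"
  shows "d (zhu_product k u v) = zhu_product k (d u) v + (-1) powi p *s zhu_product k u (d v)"
proof -
  let ?m = "\<lambda>n::nat. (of_real a gchoose n) *s mode u (int n + k) (d v)"
  let ?m' = "\<lambda>n::nat. (of_real a gchoose n) *s mode (d u) (int n + k) v"
  have "d (zhu_product k u v) = Sum_any (\<lambda>n. ?m' n + (-1) powi p *s ?m n)"
    unfolding zhu_product_bihomogeneous [OF u] residue_def
    by (subst endomorphism_Sum_any [OF d_linear finite_residue_terms], rule Sum_any.cong)
      (simp add: mode_d [OF bihomogeneous_deg [OF u]] scale_right_diff_distrib scale_left_commute)
  also have "\<dots> = Sum_any ?m' + Sum_any (\<lambda>n. (-1) powi p *s ?m n)"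
    by (rule Sum_any.distrib [OF finite_residue_terms finite_support_scale [OF finite_residue_terms]])
  also have "\<dots> = zhu_product k (d u) v + (-1) powi p *s zhu_product k u (d v)"
    unfolding zhu_product_bihomogeneous [OF u] zhu_product_bihomogeneous [OF bihomogeneous_d [OF u]]
      residue_def scale_Sum_any [OF finite_residue_terms] ..
  finally show ?thesis .
qed

lemma d_zhu_O:
  assumes "x \<in> zhu_O"
  shows "d x \<in> zhu_O"
proof (rule endomorphism_image_span [OF d_linear subspace_zhu_O])
  show "x \<in> span {zhu_circ u v | u v p a q b. bihomogeneous p a u \<and> bihomogeneous q b v}"
    using assms by (simp only: zhu_O_bihomogeneous)
  show "d y \<in> zhu_O"
    if y: "y \<in> {zhu_circ u v | u v p a q b. bihomogeneous p a u \<and> bihomogeneous q b v}" for y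
  proof -
    obtain u v p a where y: "y = zhu_circ u v" and u: "bihomogeneous p a u" using y by blast
    have "d y = zhu_circ (d u) v + (-1) powi p *s zhu_circ u (d v)"
      unfolding y zhu_circ_def by (rule d_zhu_product [OF u])
    then show ?thesis by (simp only: zhu_O_closed(1) zhu_O_closed(3) zhu_circ_in_zhu_O)
  qed
qed

text \<open>
  On components of degree exactly \<open>i\<close> the Leibniz rule is exact. A component of smaller degree
  $p < i$ may enter with the wrong sign, but then $x \ast dy$ has degree at most $i + j$ already.
\<close>

lemma zhu_star_leibniz:
  assumes "x \<in> degree_upto i" "y \<in> degree_upto j"
  shows "d (zhu_star x y) - (zhu_star (d x) y + (-1) powi i *s zhu_star x (d y)) \<in> degree_upto (i + j)"
proof (rule degree_upto_bilinear
    [of "\<lambda>x y. d (zhu_star x y) - (zhu_star (d x) y + (-1) powi i *s zhu_star x (d y))", OF _ _ _ _ assms])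
  fix p a u q b v
  assume u: "bihomogeneous p a u" "p \<le> i" and v: "bihomogeneous q b v" "q \<le> j"
  have eq: "d (zhu_star u v) = zhu_star (d u) v + (-1) powi p *s zhu_star u (d v)"
    unfolding zhu_star_def by (rule d_zhu_product [OF u(1)])
  show "d (zhu_star u v) - (zhu_star (d u) v + (-1) powi i *s zhu_star u (d v)) \<in> degree_upto (i + j)"
  proof (cases "p = i")
    case True
    then show ?thesis by (simp add: eq span_zero)
  next
    case False
    then have "zhu_star u (d v) \<in> degree_upto (i + j)"
      using u v by (intro zhu_star_degree [OF u(1) bihomogeneous_d [OF v(1)]]) simp
    then have "(-1) powi p *s zhu_star u (d v) - (-1) powi i *s zhu_star u (d v) \<in> degree_upto (i + j)"
      by (intro span_diff span_scale)
    then show ?thesis by (simp add: eq)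
  qed
qed (auto intro!: endomorphismI simp: algebra_simps)

text \<open>
  On leading components the supercommutator is \<open>residue (a - 1) 0 u v\<close> modulo \<open>zhu_O\<close>, of degree at
  most $i + j - 2$. If one factor has smaller degree than allowed, each of the two products already lies
  in the lower step.
\<close>

lemma zhu_star_filtered_commutative:
  assumes "x \<in> degree_upto i" "y \<in> degree_upto j"
  shows "\<exists>z\<in>degree_upto (i + j - 1). zhu_star x y - (-1) powi (i * j) *s zhu_star y x - z \<in> zhu_O"
proof -
  \<comment> \<open>The preimage in $V$ of the filtration step; as a subspace it is accessible to bilinear arguments.\<close>
  define S where "S = span (degree_upto (i + j - 1) \<union> zhu_O)"
  have lower: "z \<in> S" if "z \<in> degree_upto (i + j - 1)" for z
    unfolding S_def by (rule span_base) (use that in blast)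
  have O: "z \<in> S" if "z \<in> zhu_O" for z
    unfolding S_def by (rule span_base) (use that in blast)
  have "zhu_star x y - (-1) powi (i * j) *s zhu_star y x \<in> S"
  proof (rule degree_upto_bilinear
      [of "\<lambda>x y. zhu_star x y - (-1) powi (i * j) *s zhu_star y x", OF _ _ _ _ assms])
    fix p a u q b v
    assume u: "bihomogeneous p a u" "p \<le> i" and v: "bihomogeneous q b v" "q \<le> j"
    show "zhu_star u v - (-1) powi (i * j) *s zhu_star v u \<in> S"
    proof (cases "p = i \<and> q = j")
      case True
      then have "zhu_star u v - (-1) powi (i * j) *s zhu_star v u - residue (of_real a - 1) 0 u v \<in> S"
        using O [OF zhu_commutator [OF u(1) v(1)]] by simp
      moreover have "residue (of_real a - 1) 0 u v \<in> S"
        by (rule lower [OF residue_degree_upto [OF u(1) v(1)]]) (use True in simp)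
      ultimately show ?thesis
        unfolding S_def using span_add by fastforce
    next
      case False
      then have "p + q \<le> i + j - 1" using u v by auto
      then show ?thesis
        by (intro lower span_diff span_scale zhu_star_degree [OF u(1) v(1)] zhu_star_degree [OF v(1) u(1)])
          simp_all
    qed
  qed (auto simp: S_def intro!: endomorphismI simp: algebra_simps)
  then obtain z w where zw: "zhu_star x y - (-1) powi (i * j) *s zhu_star y x = z + w"
      "z \<in> degree_upto (i + j - 1)" "w \<in> zhu_O"
    unfolding S_def span_Un by (auto simp: span_span zhu_O_def)
  then show ?thesis by (intro bexI [of _ z]) simp_all
qed

section \<open>The algebra of cosets\<close>

lemma mem_zhu_class: "y \<in> zhu_class x \<longleftrightarrow> y - x \<in> zhu_O"
  unfolding zhu_class_def by (auto intro: exI [of _ "y - x"])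

lemma zhu_class_eq_iff: "zhu_class x = zhu_class y \<longleftrightarrow> x - y \<in> zhu_O"
proof
  assume "zhu_class x = zhu_class y"
  moreover have "x \<in> zhu_class x" by (simp add: mem_zhu_class zhu_O_closed)
  ultimately show "x - y \<in> zhu_O" by (simp add: mem_zhu_class)
next
  assume xy: "x - y \<in> zhu_O"
  show "zhu_class x = zhu_class y"
    unfolding set_eq_iff mem_zhu_class
  proof
    fix z
    have "z - y = (z - x) + (x - y)" "z - x = (z - y) - (x - y)" by simp_all
    then show "z - x \<in> zhu_O \<longleftrightarrow> z - y \<in> zhu_O"
      using zhu_O_closed(1) [OF _ xy] zhu_O_closed(2) [OF _ xy] by metis
  qed
qed

text \<open>
  The operations on cosets are unions over all representatives; such a union collapses to a single
  coset once the operation respects congruence modulo \<open>zhu_O\<close>.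
\<close>

lemma UN_zhu_class:
  assumes "\<And>y. y - x \<in> zhu_O \<Longrightarrow> f y = f x"
  shows "(\<Union>y\<in>zhu_class x. f y) = f x"
proof -
  have "x \<in> zhu_class x" by (simp add: mem_zhu_class zhu_O_closed)
  moreover have "f y = f x" if "y \<in> zhu_class x" for y
    by (rule assms) (use that in \<open>simp only: mem_zhu_class\<close>)
  ultimately have "f ` zhu_class x = {f x}" by blast
  then show ?thesis by simp
qed

lemma zhu_algebra_carrier: "carrier zhu_algebra = range zhu_class"
  by (simp add: zhu_algebra_def)

lemma zhu_algebra_zero: "\<zero>\<^bsub>zhu_algebra\<^esub> = zhu_class 0"
  by (simp add: zhu_algebra_def)

lemma zhu_algebra_add: "zhu_class x \<oplus>\<^bsub>zhu_algebra\<^esub> zhu_class y = zhu_class (x + y)"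
proof -
  have "(\<Union>y'\<in>zhu_class y. zhu_class (x' + y')) = zhu_class (x' + y)" for x'
    by (rule UN_zhu_class) (simp add: zhu_class_eq_iff)
  moreover have "(\<Union>x'\<in>zhu_class x. zhu_class (x' + y)) = zhu_class (x + y)"
    by (rule UN_zhu_class) (simp add: zhu_class_eq_iff)
  ultimately show ?thesis by (simp add: zhu_algebra_def)
qed

lemma zhu_algebra_smult: "c \<odot>\<^bsub>zhu_algebra\<^esub> zhu_class x = zhu_class (c *s x)"
proof -
  have "(\<Union>x'\<in>zhu_class x. zhu_class (c *s x')) = zhu_class (c *s x)"
    by (rule UN_zhu_class) (metis zhu_class_eq_iff zhu_O_closed(3) scale_right_diff_distrib)
  then show ?thesis by (simp add: zhu_algebra_def)
qed

lemma zhu_algebra_mult: "zhu_class x \<otimes>\<^bsub>zhu_algebra\<^esub> zhu_class y = zhu_class (zhu_star x y)"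
proof -
  have "(\<Union>y'\<in>zhu_class y. zhu_class (zhu_star x' y')) = zhu_class (zhu_star x' y)" for x'
    by (rule UN_zhu_class)
      (metis zhu_class_eq_iff zhu_star_zhu_O_right endomorphism_diff [OF zhu_star_linear_right])
  moreover have "(\<Union>x'\<in>zhu_class x. zhu_class (zhu_star x' y)) = zhu_class (zhu_star x y)"
    by (rule UN_zhu_class)
      (metis zhu_class_eq_iff zhu_star_zhu_O_left endomorphism_diff [OF zhu_star_linear_left])
  ultimately show ?thesis by (simp add: zhu_algebra_def)
qed

lemma zhu_d_class: "zhu_d (zhu_class x) = zhu_class (d x)"
  unfolding zhu_d_def
  by (rule UN_zhu_class) (metis zhu_class_eq_iff d_zhu_O endomorphism_diff [OF d_linear])

lemmas zhu_algebra_simps =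
  zhu_algebra_zero zhu_algebra_add zhu_algebra_smult zhu_algebra_mult zhu_d_class

lemma zhu_algebra_module: "Module.module complex_ring zhu_algebra"
proof (rule moduleI)
  show "cring complex_ring" by (rule cring_from_type_algebra)
  show "abelian_group zhu_algebra"
  proof (rule abelian_groupI)
    show "\<exists>y\<in>carrier zhu_algebra. y \<oplus>\<^bsub>zhu_algebra\<^esub> x = \<zero>\<^bsub>zhu_algebra\<^esub>"
      if "x \<in> carrier zhu_algebra" for x
    proof -
      obtain v where "x = zhu_class v" using \<open>x \<in> carrier zhu_algebra\<close> by (auto simp: zhu_algebra_carrier)
      then show ?thesis
        by (intro bexI [of _ "zhu_class (- v)"]) (auto simp: zhu_algebra_simps zhu_algebra_carrier)
    qed
  qed (auto simp: zhu_algebra_carrier zhu_algebra_simps ac_simps)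
qed (auto simp: zhu_algebra_carrier zhu_algebra_simps ring_of_type_algebra_def
    scale_left_distrib scale_right_distrib)

lemma zhu_algebra_uminus: "\<ominus>\<^bsub>zhu_algebra\<^esub> zhu_class x = zhu_class (- x)"
proof -
  interpret A: Module.module complex_ring zhu_algebra by (rule zhu_algebra_module)
  show ?thesis
    by (rule A.M.minus_equality) (auto simp: zhu_algebra_simps zhu_algebra_carrier)
qed

lemma zhu_algebra_minus: "zhu_class x \<ominus>\<^bsub>zhu_algebra\<^esub> zhu_class y = zhu_class (x - y)"
  by (simp add: a_minus_def zhu_algebra_uminus zhu_algebra_simps)

lemma zhu_filtration_iff: "zhu_class v \<in> zhu_filtration p \<longleftrightarrow> (\<exists>x\<in>degree_upto p. v - x \<in> zhu_O)"
  by (auto simp: zhu_filtration_def zhu_class_eq_iff image_iff)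

lemma zhu_filtrationI: "x \<in> degree_upto p \<Longrightarrow> zhu_class x \<in> zhu_filtration p"
  by (simp add: zhu_filtration_def)

lemma zhu_filtrationE:
  assumes "S \<in> zhu_filtration p"
  obtains x where "x \<in> degree_upto p" "S = zhu_class x"
  using assms by (auto simp: zhu_filtration_def)

lemma zhu_class_exhaustive: "\<exists>p. zhu_class v \<in> zhu_filtration p"
  using degree_upto_exhaustive zhu_filtrationI by blast

lemma zhu_filtration_mono: "i \<le> j \<Longrightarrow> zhu_filtration i \<subseteq> zhu_filtration j"
  unfolding zhu_filtration_def by (intro image_mono degree_upto_mono)

lemma zhu_filtration_Inter:
  assumes "\<And>p. zhu_class v \<in> zhu_filtration p"
  shows "zhu_class v = zhu_class 0"
  using zhu_filtration_separated [of v] assms by (simp add: zhu_filtration_iff zhu_class_eq_iff)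

text \<open>
  Every nonzero class has a representative whose degrees do not exceed its filtration degree. The
  Leibniz rule and commutativity are then instances of the statements about representatives.
\<close>

lemma zhu_filtration_degree:
  assumes "S \<in> carrier zhu_algebra" "S \<noteq> \<zero>\<^bsub>zhu_algebra\<^esub>"
  obtains x where "S = zhu_class x" "x \<in> degree_upto (filtration_degree zhu_filtration S)"
proof -
  obtain v where v: "S = zhu_class v" using assms(1) by (auto simp: zhu_algebra_carrier)
  obtain i where i: "S \<in> zhu_filtration i" using zhu_class_exhaustive v by blast
  obtain k where k: "S \<notin> zhu_filtration k"
    using zhu_filtration_Inter [of v] assms(2) by (auto simp: v zhu_algebra_zero)
  have "S \<in> zhu_filtration (filtration_degree zhu_filtration S)"
    by (rule filtration_degree_mem [OF zhu_filtration_mono i k])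
  then show thesis using that by (auto elim: zhu_filtrationE)
qed

lemma zhu_filtration_submodule: "submodule (zhu_filtration i) complex_ring zhu_algebra"
proof -
  interpret A: Module.module complex_ring zhu_algebra by (rule zhu_algebra_module)
  show ?thesis
    by (rule A.submoduleI)
      (auto elim!: zhu_filtrationE intro!: zhu_filtrationI span_zero span_add span_scale span_neg
        simp: zhu_algebra_simps zhu_algebra_carrier zhu_algebra_uminus)
qed

lemma zhu_differential_filtered_vector_space:
  "differential_filtered_vector_space zhu_algebra zhu_filtration zhu_d"
proof (intro differential_filtered_vector_space.intro zhu_algebra_module
    differential_filtered_vector_space_axioms.intro)
  show "(\<Inter>i. zhu_filtration i) = {\<zero>\<^bsub>zhu_algebra\<^esub>}"
  proof (intro equalityI subsetI)
    fix S assume S: "S \<in> (\<Inter>i. zhu_filtration i)"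
    then have "S \<in> zhu_filtration 0" by blast
    then obtain v where "S = zhu_class v" by (rule zhu_filtrationE)
    then show "S \<in> {\<zero>\<^bsub>zhu_algebra\<^esub>}"
      using S zhu_filtration_Inter [of v] by (simp add: zhu_algebra_zero)
  qed (auto simp: zhu_algebra_zero intro: zhu_filtrationI span_zero)
  show "(\<Union>i. zhu_filtration i) = carrier zhu_algebra"
    using zhu_class_exhaustive by (auto simp: zhu_algebra_carrier elim: zhu_filtrationE)
  show "zhu_filtration i \<subseteq> zhu_filtration j" if "i \<le> j" for i j
    using that by (rule zhu_filtration_mono)
qed (auto simp: zhu_algebra_carrier zhu_algebra_simps d_d elim!: zhu_filtrationE
    intro!: zhu_filtrationI d_degree_upto span_zero zhu_filtration_submodule)

lemma zhu_differential_filtered_algebra: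
  "differential_filtered_algebra zhu_algebra zhu_filtration zhu_d"
proof (intro differential_filtered_algebra.intro zhu_differential_filtered_vector_space
    differential_filtered_algebra_axioms.intro)
  fix S T
  assume "S \<in> carrier zhu_algebra" "S \<noteq> \<zero>\<^bsub>zhu_algebra\<^esub>"
  then obtain x where x: "S = zhu_class x" "x \<in> degree_upto (filtration_degree zhu_filtration S)"
    by (rule zhu_filtration_degree)
  assume "T \<in> carrier zhu_algebra" "T \<noteq> \<zero>\<^bsub>zhu_algebra\<^esub>"
  then obtain y where y: "T = zhu_class y" "y \<in> degree_upto (filtration_degree zhu_filtration T)"
    by (rule zhu_filtration_degree)
  from zhu_filtrationI [OF zhu_star_leibniz [OF x(2) y(2)]]
  show "zhu_d (S \<otimes>\<^bsub>zhu_algebra\<^esub> T) \<ominus>\<^bsub>zhu_algebra\<^esub>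
      (zhu_d S \<otimes>\<^bsub>zhu_algebra\<^esub> T \<oplus>\<^bsub>zhu_algebra\<^esub>
        ((-1) powi filtration_degree zhu_filtration S) \<odot>\<^bsub>zhu_algebra\<^esub> (S \<otimes>\<^bsub>zhu_algebra\<^esub> zhu_d T))
    \<in> zhu_filtration (filtration_degree zhu_filtration S + filtration_degree zhu_filtration T)"
    unfolding x(1) y(1) zhu_algebra_simps zhu_algebra_minus by simp
qed (auto simp: zhu_algebra_carrier zhu_algebra_simps
      zhu_class_eq_iff [THEN iffD2, OF zhu_star_assoc]
    elim!: zhu_filtrationE intro!: zhu_filtrationI zhu_star_degree_upto)

lemma zhu_differential_filtered_commutative_algebra:
  "differential_filtered_commutative_algebra zhu_algebra zhu_filtration zhu_d"
proof (intro differential_filtered_commutative_algebra.intro zhu_differential_filtered_algebra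
    differential_filtered_commutative_algebra_axioms.intro)
  fix S T
  assume "S \<in> carrier zhu_algebra" "S \<noteq> \<zero>\<^bsub>zhu_algebra\<^esub>"
  then obtain x where x: "S = zhu_class x" "x \<in> degree_upto (filtration_degree zhu_filtration S)"
    by (rule zhu_filtration_degree)
  assume "T \<in> carrier zhu_algebra" "T \<noteq> \<zero>\<^bsub>zhu_algebra\<^esub>"
  then obtain y where y: "T = zhu_class y" "y \<in> degree_upto (filtration_degree zhu_filtration T)"
    by (rule zhu_filtration_degree)
  from zhu_star_filtered_commutative [OF x(2) y(2)]
  show "S \<otimes>\<^bsub>zhu_algebra\<^esub> T \<ominus>\<^bsub>zhu_algebra\<^esub>
      ((-1) powi (filtration_degree zhu_filtration S * filtration_degree zhu_filtration T))
        \<odot>\<^bsub>zhu_algebra\<^esub> (T \<otimes>\<^bsub>zhu_algebra\<^esub> S)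
    \<in> zhu_filtration (filtration_degree zhu_filtration S + filtration_degree zhu_filtration T - 1)"
    unfolding x(1) y(1) zhu_algebra_simps zhu_algebra_minus zhu_filtration_iff .
qed

end

theorem theorem6p6:
  fixes scale :: "complex \<Rightarrow> 'v::ab_group_add \<Rightarrow> 'v"
    and deg :: "int \<Rightarrow> 'v set" and d :: "'v \<Rightarrow> 'v"
    and mode :: "'v \<Rightarrow> int \<Rightarrow> 'v \<Rightarrow> 'v" and vac \<omega> :: 'v
  assumes "dg_vertex_operator_algebra scale deg d mode vac \<omega>"
  shows "differential_filtered_commutative_algebra
    (dg_vertex_operator_algebra.zhu_algebra scale mode vac \<omega>)
    (dg_vertex_operator_algebra.zhu_filtration scale deg mode \<omega>)
    (dg_vertex_operator_algebra.zhu_d scale d mode \<omega>)"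
  by (rule dg_vertex_operator_algebra.zhu_differential_filtered_commutative_algebra [OF assms])

end
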